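(* For $m$-qubit quantum states $\rho,\sigma$, $O((6\sqrt2)^m/\epsilon^2)$ copies are sufficient to distinguish, with probability of success at least $\frac23$, the case $\rho=\sigma$ from the case $\|\rho-\sigma\|_1\ge\epsilon$ using a streaming algorithm. That is, there is an absolute constant $K$ such that for every $m\ge1$ and $\epsilon\in(0,1]$ there is a streaming algorithm which uses at most $K(6\sqrt2)^m/\epsilon^2$ copies of each of two unknown $m$-qubit states $\rho,\sigma$ and outputs "Yes" with probability at least $\frac23$ if $\rho=\sigma$, and "No" with probability at least $\frac23$ if $\|\rho-\sigma\|_1\ge\epsilon$.
   Context: An $m$-qubit state is a density operator on $(\mathbb{C}^2)^{\otimes m}$. $\|A\|_1=\operatorname{Tr}\sqrt{A^\dagger A}$. A streaming algorithm (local measurement) measures each qubit of each copy separately with a one-qubit POVM, all these POVMs being fixed in advance (non-adaptive), so that the overall POVM is a tensor product of one-qubit POVMs; the outcomes are then processed classically. *)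

theory Defs
  imports Complex_Main "Jordan_Normal_Form.Schur_Decomposition"
begin

definition mat_trace :: "complex mat \<Rightarrow> complex" where
  "mat_trace A = (\<Sum>i<dim_row A. A $$ (i, i))"

(* On complex numbers 0 \<le> z means that z is real and nonnegative, so this condition
   already forces A to be Hermitian. *)
definition positive_semidefinite :: "nat \<Rightarrow> complex mat \<Rightarrow> bool" where
  "positive_semidefinite d A \<longleftrightarrow>
     A \<in> carrier_mat d d \<and> (\<forall>v \<in> carrier_vec d. 0 \<le> (A *\<^sub>v v) \<bullet>c v)"

definition density_operator :: "nat \<Rightarrow> complex mat \<Rightarrow> bool" where
  "density_operator d \<rho> \<longleftrightarrow> positive_semidefinite d \<rho> \<and> mat_trace \<rho> = 1"

(* The principal square root of a positive semidefinite matrix; it exists and is unique. *)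
definition psd_sqrt :: "complex mat \<Rightarrow> complex mat" where
  "psd_sqrt A = (SOME R. positive_semidefinite (dim_row A) R \<and> R * R = A)"

definition trace_norm :: "complex mat \<Rightarrow> real" where
  "trace_norm A = Re (mat_trace (psd_sqrt (mat_adjoint A * A)))"

definition kronecker :: "complex mat \<Rightarrow> complex mat \<Rightarrow> complex mat" where
  "kronecker A B =
     mat (dim_row A * dim_row B) (dim_col A * dim_col B)
       (\<lambda>(i, j). A $$ (i div dim_row B, j div dim_col B) * B $$ (i mod dim_row B, j mod dim_col B))"

definition tensor_list :: "complex mat list \<Rightarrow> complex mat" where
  "tensor_list As = foldr kronecker As (1\<^sub>m 1)"

(* (C^2)^{(x) m} is identified with C^(2^m) through the computational basis, the first qubit
   being the most significant binary digit of the index; this agrees with kronecker. *)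
abbreviation qubit_state :: "nat \<Rightarrow> complex mat \<Rightarrow> bool" where
  "qubit_state m \<equiv> density_operator (2 ^ m)"

(* A POVM is the list of its effects; its outcomes are the positions in the list. *)
definition povm :: "nat \<Rightarrow> complex mat list \<Rightarrow> bool" where
  "povm d Es \<longleftrightarrow> (\<forall>E \<in> set Es. positive_semidefinite d E) \<and> foldr (+) Es (0\<^sub>m d d) = 1\<^sub>m d"

(* One one-qubit POVM for each of N qubits, all chosen in advance. *)
definition local_measurement :: "nat \<Rightarrow> complex mat list list \<Rightarrow> bool" where
  "local_measurement N Ms \<longleftrightarrow> length Ms = N \<and> (\<forall>Es \<in> set Ms. povm 2 Es)"

definition outcomes :: "complex mat list list \<Rightarrow> nat list set" where
  "outcomes Ms = listset (map (\<lambda>Es. {..<length Es}) Ms)"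

definition effect :: "complex mat list list \<Rightarrow> nat list \<Rightarrow> complex mat" where
  "effect Ms x = tensor_list (map2 (!) Ms x)"

datatype answer = Yes | No

definition answer_prob ::
  "complex mat list list \<Rightarrow> (nat list \<Rightarrow> answer) \<Rightarrow> complex mat \<Rightarrow> answer \<Rightarrow> real" where
  "answer_prob Ms decide \<omega> a =
     (\<Sum>x \<in> {x \<in> outcomes Ms. decide x = a}. Re (mat_trace (effect Ms x * \<omega>)))"

(* For m-qubit \<rho> and \<sigma> this is a state of 2 * n * m qubits. *)
definition joint_copies :: "nat \<Rightarrow> complex mat \<Rightarrow> complex mat \<Rightarrow> complex mat" where
  "joint_copies n \<rho> \<sigma> = tensor_list (replicate n \<rho> @ replicate n \<sigma>)"

end

(* Every qubit is measured with the tetrahedral four-outcome POVM. The induced outcome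
   distributions p, q on 4^m points are bounded by 2^-m, because the effects are 2^-m times
   rank-one projections, and the outcome map A -> (tr (E_x A))_x shrinks the squared Frobenius
   norm by at most 6^m, since it does so by 6 on one qubit and is a tensor power. As the squared
   trace norm is at most 2^m times the squared Frobenius norm, |p - q|^2 >= eps^2 / 12^m when the
   trace distance is at least eps. It remains to test p = q against a lower bound theta on
   |p - q|^2 when all probabilities are at most beta. The inner product of the count differences of
   two independent batches of n samples from p and q has mean n^2 |p - q|^2 and variance at most
   4 beta n^2 + 4 beta n^3 |p - q|^2, so by Chebyshev n of order sqrt beta / theta suffices, which
   is 2^(-m/2) 12^m / eps^2 = (6 sqrt 2)^m / eps^2. *)

theory Submission
  imports Defs
begin

section \<open>Testing closeness in Euclidean distance\<close>

text \<open>The constant 6 comes from the tetrahedral vectors forming a 2-design: for every complex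
  2 x 2 matrix X, the squared values |tr (E_a X)|^2 add up to (|X|_F^2 + |tr X|^2) / 6. The trace
  term is discarded. A difference of states has trace zero, but the blocks met when one qubit is
  split off need be neither traceless nor Hermitian; hence the one-qubit estimate is stated for
  arbitrary complex matrices and the values are kept complex until the end.

  The cap \<beta> = 2^-m on the outcome probabilities is what improves on 12^m: with only \<beta> =
  1 the same test would ask for order 1 / \<theta> = 12^m / \<epsilon>^2 samples, and the cap saves
  the factor sqrt \<beta>.

  Since \<open>trace_norm\<close> refers to a root picked by choice, any estimate on it presupposes
  that a positive semidefinite root exists. This existence is proved for A * A with A Hermitian, by
  splitting off one eigenvector at a time.

  All probability is finite: expectations are nested weighted sums over lists of samples, and the
  Born rule for product measurements on product states is shown to produce exactly such
  sums.\<close>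

text \<open>There is one weight function per position, so that a block of samples from
  \<open>p\<close> followed by a block from \<open>q\<close> is a single product
  distribution.\<close>

fun expect :: "'a set \<Rightarrow> ('a \<Rightarrow> real) list \<Rightarrow> ('a list \<Rightarrow> real) \<Rightarrow> real" where
  "expect S [] F = F []"
| "expect S (p # ps) F = (\<Sum>a\<in>S. p a * expect S ps (\<lambda>xs. F (a # xs)))"

lemma expect_append:
  "expect S (ps @ qs) F = expect S ps (\<lambda>xs. expect S qs (\<lambda>ys. F (xs @ ys)))"
  by (induction ps arbitrary: F) simp_all

lemma expect_add: "expect S ps (\<lambda>xs. F xs + G xs) = expect S ps F + expect S ps G"
  by (induction ps arbitrary: F G) (simp_all add: sum.distrib distrib_left)

lemma expect_cmult: "expect S ps (\<lambda>xs. c * F xs) = c * expect S ps F"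
  by (induction ps arbitrary: F) (simp_all add: sum_distrib_left mult.left_commute)

lemma expect_diff: "expect S ps (\<lambda>xs. F xs - G xs) = expect S ps F - expect S ps G"
  using expect_add[of S ps F "\<lambda>xs. (-1) * G xs"] expect_cmult[of S ps "-1" G] by simp

lemma expect_sum: "finite I \<Longrightarrow> expect S ps (\<lambda>xs. \<Sum>i\<in>I. F i xs) = (\<Sum>i\<in>I. expect S ps (F i))"
proof (induction I rule: finite_induct)
  case empty
  show ?case using expect_cmult[of S ps 0 "\<lambda>_. 0"] by simp
qed (simp add: expect_add)

lemma expect_cong:
  assumes "\<And>xs. length xs = length ps \<Longrightarrow> set xs \<subseteq> S \<Longrightarrow> F xs = G xs"
  shows "expect S ps F = expect S ps G"
  using assms
proof (induction ps arbitrary: F G)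
  case (Cons p ps)
  have "expect S ps (\<lambda>xs. F (a # xs)) = expect S ps (\<lambda>xs. G (a # xs))" if "a \<in> S" for a
    using that by (intro Cons.IH Cons.prems) auto
  then show ?case by simp
qed simp

definition prob_weights :: "'a set \<Rightarrow> ('a \<Rightarrow> real) \<Rightarrow> bool" where
  "prob_weights S p \<longleftrightarrow> (\<forall>a\<in>S. 0 \<le> p a) \<and> sum p S = 1"

lemma expect_mono:
  assumes "\<forall>p\<in>set ps. prob_weights S p" "\<And>xs. F xs \<le> G xs"
  shows "expect S ps F \<le> expect S ps G"
  using assms
proof (induction ps arbitrary: F G)
  case (Cons p ps)
  then show ?case
    by (auto simp: prob_weights_def intro!: sum_mono mult_left_mono)
qed simp

lemma expect_const:
  assumes "\<forall>p\<in>set ps. sum p S = 1"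
  shows "expect S ps (\<lambda>_. c) = c"
  using assms
proof (induction ps)
  case (Cons p ps)
  then show ?case by (simp flip: sum_distrib_right)
qed simp

lemma expect_swap:
  "expect S ps (\<lambda>xs. expect S qs (F xs)) = expect S qs (\<lambda>ys. expect S ps (\<lambda>xs. F xs ys))"
proof (induction ps arbitrary: F)
  case (Cons p ps)
  show ?case
  proof (cases "finite S")
    case True
    then show ?thesis by (simp add: Cons.IH expect_sum expect_cmult)
  next
    \<comment> \<open>Sums over an infinite set are 0 by convention, so the left side is 0 and the
      right side is the expectation of the constant 0.\<close>
    case False
    then show ?thesis using expect_cmult[of S qs 0 "\<lambda>_. 0"] by simp
  qed
qed simp

text \<open>Pointwise the indicator of \<open>A\<close> dominates 1 - (Z - \<mu>)^2 / t^2: off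
  \<open>A\<close> this is at most 0, on \<open>A\<close> at most 1. Taking expectations gives
  Chebyshev's inequality.\<close>

lemma expect_chebyshev:
  assumes "\<forall>p\<in>set ps. prob_weights S p" "0 < t"
    and "\<And>xs. \<not> A xs \<Longrightarrow> t \<le> \<bar>Z xs - \<mu>\<bar>"
    and "expect S ps (\<lambda>xs. (Z xs - \<mu>)\<^sup>2) \<le> v"
  shows "expect S ps (\<lambda>xs. of_bool (A xs)) \<ge> 1 - v / t\<^sup>2"
proof -
  have w: "\<forall>p\<in>set ps. sum p S = 1"
    using assms(1) by (auto simp: prob_weights_def)
  have "1 - v / t\<^sup>2 \<le> expect S ps (\<lambda>xs. 1 - 1 / t\<^sup>2 * (Z xs - \<mu>)\<^sup>2)"
    unfolding expect_diff expect_cmult expect_const[OF w] using assms(2,4) by (simp add: divide_right_mono)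
  also have "\<dots> \<le> expect S ps (\<lambda>xs. of_bool (A xs))"
  proof (rule expect_mono[OF assms(1)])
    fix xs
    show "1 - 1 / t\<^sup>2 * (Z xs - \<mu>)\<^sup>2 \<le> of_bool (A xs)"
    proof (cases "A xs")
      case False
      then have "t\<^sup>2 \<le> (Z xs - \<mu>)\<^sup>2"
        using assms(2) assms(3)[OF False] by (simp add: abs_le_square_iff[symmetric])
      then show ?thesis using assms(2) False by simp
    qed simp
  qed
  finally show ?thesis .
qed

text \<open>The offset \<open>c\<close> is what the induction needs: each step absorbs the value of
  the leading sample into it.\<close>

lemma expect_sum_list:
  assumes "sum p S = 1"
  shows "expect S (replicate n p) (\<lambda>xs. c + sum_list (map \<phi> xs)) = c + n * (\<Sum>a\<in>S. p a * \<phi> a)"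
proof (induction n arbitrary: c)
  case (Suc n)
  have "expect S (replicate (Suc n) p) (\<lambda>xs. c + sum_list (map \<phi> xs))
      = (\<Sum>a\<in>S. p a * (c + \<phi> a + n * (\<Sum>a\<in>S. p a * \<phi> a)))"
    by (simp add: Suc.IH flip: add.assoc)
  also have "\<dots> = (\<Sum>a\<in>S. p a * (c + n * (\<Sum>a\<in>S. p a * \<phi> a))) + (\<Sum>a\<in>S. p a * \<phi> a)"
    unfolding sum.distrib[symmetric] by (rule sum.cong) (simp_all add: distrib_left)
  also have "\<dots> = c + n * (\<Sum>a\<in>S. p a * \<phi> a) + (\<Sum>a\<in>S. p a * \<phi> a)"
    using assms by (simp flip: sum_distrib_right)
  finally show ?case by (simp add: distrib_right)
qed simp

text \<open>Variance of a sum of independent samples plus the square of its mean, with the offset in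
  the same role as for the first moment.\<close>

lemma expect_sum_list_square:
  assumes "sum p S = 1"
  shows "expect S (replicate n p) (\<lambda>xs. (c + sum_list (map \<phi> xs))\<^sup>2) =
    n * ((\<Sum>a\<in>S. p a * (\<phi> a)\<^sup>2) - (\<Sum>a\<in>S. p a * \<phi> a)\<^sup>2) + (c + n * (\<Sum>a\<in>S. p a * \<phi> a))\<^sup>2"
proof (induction n arbitrary: c)
  case (Suc n)
  define \<mu> where "\<mu> = (\<Sum>a\<in>S. p a * \<phi> a)"
  define V where "V = (\<Sum>a\<in>S. p a * (\<phi> a)\<^sup>2)"
  define c' where "c' = c + n * \<mu>"
  have "expect S (replicate (Suc n) p) (\<lambda>xs. (c + sum_list (map \<phi> xs))\<^sup>2)
      = (\<Sum>a\<in>S. p a * (n * (V - \<mu>\<^sup>2) + (c + \<phi> a + n * \<mu>)\<^sup>2))"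
    using Suc.IH by (simp add: \<mu>_def V_def flip: add.assoc)
  also have "\<dots> = (\<Sum>a\<in>S. p a * (n * (V - \<mu>\<^sup>2) + c'\<^sup>2) + 2 * c' * (p a * \<phi> a) + p a * (\<phi> a)\<^sup>2)"
    by (rule sum.cong) (auto simp: c'_def power2_eq_square algebra_simps)
  also have "\<dots> = n * (V - \<mu>\<^sup>2) + c'\<^sup>2 + 2 * c' * \<mu> + V"
    using assms by (simp add: sum.distrib \<mu>_def V_def flip: sum_distrib_right sum_distrib_left)
  also have "\<dots> = Suc n * (V - \<mu>\<^sup>2) + (c + Suc n * \<mu>)\<^sup>2"
    by (simp add: c'_def power2_eq_square algebra_simps)
  finally show ?case
    by (simp only: \<mu>_def V_def)
qed simp

section \<open>Moments of linear statistics of two samples\<close>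

text \<open>The pairing of \<open>\<phi>\<close> with the difference of the two count
  vectors.\<close>

definition sample_diff :: "('a \<Rightarrow> real) \<Rightarrow> 'a list \<Rightarrow> 'a list \<Rightarrow> real" where
  "sample_diff \<phi> xs ys = sum_list (map \<phi> xs) - sum_list (map \<phi> ys)"

text \<open>Expectation over one batch, \<open>n\<close> samples from \<open>p\<close> and
  \<open>n\<close> from \<open>q\<close>. Nesting it twice describes two independent
  batches.\<close>

definition expect2 ::
  "'a set \<Rightarrow> nat \<Rightarrow> ('a \<Rightarrow> real) \<Rightarrow> ('a \<Rightarrow> real) \<Rightarrow> ('a list \<Rightarrow> 'a list \<Rightarrow> real) \<Rightarrow> real" where
  "expect2 S n p q F = expect S (replicate n p) (\<lambda>xs. expect S (replicate n q) (F xs))"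

lemma sample_diff_eq: "sample_diff \<phi> xs ys = sum_list (map \<phi> xs) + sum_list (map (\<lambda>a. - \<phi> a) ys)"
proof -
  have "sum_list (map (\<lambda>a. - \<phi> a) ys) = - sum_list (map \<phi> ys)"
    by (induction ys) simp_all
  then show ?thesis by (simp add: sample_diff_def)
qed

lemma expect2_sample_diff:
  assumes "sum p S = 1" "sum q S = 1"
  shows "expect2 S n p q (sample_diff \<phi>) = n * (\<Sum>a\<in>S. (p a - q a) * \<phi> a)"
proof -
  have "expect2 S n p q (sample_diff \<phi>)
    = expect S (replicate n p) (\<lambda>xs. - (n * (\<Sum>a\<in>S. q a * \<phi> a)) + sum_list (map \<phi> xs))"
    by (simp add: expect2_def sample_diff_eq[abs_def] expect_sum_list[OF assms(2)] sum_negf)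
  also have "\<dots> = n * (\<Sum>a\<in>S. p a * \<phi> a) - n * (\<Sum>a\<in>S. q a * \<phi> a)"
    by (subst expect_sum_list[OF assms(1)]) simp
  finally show ?thesis by (simp add: left_diff_distrib sum_subtractf right_diff_distrib)
qed

lemma expect2_sample_diff_square:
  assumes "sum p S = 1" "sum q S = 1"
  shows "expect2 S n p q (\<lambda>xs ys. (sample_diff \<phi> xs ys)\<^sup>2)
    \<le> n * (\<Sum>a\<in>S. (p a + q a) * (\<phi> a)\<^sup>2) + (n * (\<Sum>a\<in>S. (p a - q a) * \<phi> a))\<^sup>2"
proof -
  define a where "a = (\<Sum>a\<in>S. p a * \<phi> a)"
  define b where "b = (\<Sum>a\<in>S. q a * \<phi> a)"
  define A where "A = (\<Sum>a\<in>S. p a * (\<phi> a)\<^sup>2)"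
  define B where "B = (\<Sum>a\<in>S. q a * (\<phi> a)\<^sup>2)"
  have "expect2 S n p q (\<lambda>xs ys. (sample_diff \<phi> xs ys)\<^sup>2)
    = expect S (replicate n p) (\<lambda>xs. n * (B - b\<^sup>2) + (- (n * b) + sum_list (map \<phi> xs))\<^sup>2)"
    by (simp add: expect2_def sample_diff_eq expect_sum_list_square[OF assms(2)] sum_negf
        B_def b_def algebra_simps)
  also have "\<dots> = n * (B - b\<^sup>2) + (n * (A - a\<^sup>2) + (- (n * b) + n * a)\<^sup>2)"
    unfolding expect_add expect_sum_list_square[OF assms(1)] A_def a_def
    using assms(1) by (subst expect_const) auto
  \<comment> \<open>The variances are bounded by second moments: the terms with
    \<open>a\<^sup>2\<close> and \<open>b\<^sup>2\<close> are dropped, which leaves a bound linear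
    in \<open>p + q\<close>.\<close>
  also have "\<dots> \<le> n * (A + B) + (n * (a - b))\<^sup>2"
    by (simp add: algebra_simps)
  finally show ?thesis
    by (simp add: A_def B_def a_def b_def left_diff_distrib sum_subtractf distrib_right sum.distrib)
qed

text \<open>Splitting every sample in two halves makes the collision statistic bilinear in two
  independent count vectors, so that its variance needs only second moments.\<close>

definition collision_stat :: "nat \<Rightarrow> 'a list \<Rightarrow> real" where
  "collision_stat n xs = (let x1 = take n xs; x2 = take n (drop n xs);
     y1 = take n (drop (2 * n) xs); y2 = drop (3 * n) xs in
     sample_diff (\<lambda>s. sample_diff (\<lambda>a. of_bool (a = s)) x1 y1) x2 y2)"

text \<open>The samples arrive in the order x1, x2, y1, y2, all of \<open>p\<close> before all of
  \<open>q\<close>. Exchanging the expectations over x2 and y1 regroups them into the two batches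
  (x1, y1) and (x2, y2).\<close>

lemma expect_collision:
  fixes H :: "real \<Rightarrow> real"
  shows "expect S (replicate (2 * n) p @ replicate (2 * n) q) (\<lambda>xs. H (collision_stat n xs))
    = expect2 S n p q (\<lambda>x1 y1. expect2 S n p q (\<lambda>x2 y2.
        H (sample_diff (\<lambda>s. sample_diff (\<lambda>a. of_bool (a = s)) x1 y1) x2 y2)))"
proof -
  have rep: "replicate (2 * n) r = replicate n r @ replicate n r" for r :: "'a \<Rightarrow> real"
    by (simp add: mult_2 replicate_add)
  have "expect S (replicate (2 * n) p @ replicate (2 * n) q) (\<lambda>xs. H (collision_stat n xs))
    = expect S (replicate n p) (\<lambda>x1. expect S (replicate n p) (\<lambda>x2. expect S (replicate n q)
      (\<lambda>y1. expect S (replicate n q) (\<lambda>y2. H (collision_stat n (x1 @ x2 @ y1 @ y2))))))"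
    unfolding rep by (simp add: expect_append)
  also have "\<dots> = expect S (replicate n p) (\<lambda>x1. expect S (replicate n p) (\<lambda>x2. expect S (replicate n q)
      (\<lambda>y1. expect S (replicate n q) (\<lambda>y2.
        H (sample_diff (\<lambda>s. sample_diff (\<lambda>a. of_bool (a = s)) x1 y1) x2 y2)))))"
    by (intro expect_cong) (simp add: collision_stat_def)
  also have "\<dots> = expect S (replicate n p) (\<lambda>x1. expect S (replicate n q) (\<lambda>y1. expect S (replicate n p)
      (\<lambda>x2. expect S (replicate n q) (\<lambda>y2.
        H (sample_diff (\<lambda>s. sample_diff (\<lambda>a. of_bool (a = s)) x1 y1) x2 y2)))))"
    by (subst expect_swap) simp
  finally show ?thesis
    unfolding expect2_def .
qed

lemma expect2_add: "expect2 S n p q (\<lambda>x y. F x y + G x y) = expect2 S n p q F + expect2 S n p q G"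
  by (simp add: expect2_def expect_add)

lemma expect2_cmult: "expect2 S n p q (\<lambda>x y. c * F x y) = c * expect2 S n p q F"
  by (simp add: expect2_def expect_cmult)

lemma expect2_sum:
  "finite I \<Longrightarrow> expect2 S n p q (\<lambda>x y. \<Sum>i\<in>I. F i x y) = (\<Sum>i\<in>I. expect2 S n p q (F i))"
  by (simp add: expect2_def expect_sum)

lemma expect2_mono:
  assumes "prob_weights S p" "prob_weights S q" "\<And>x y. F x y \<le> G x y"
  shows "expect2 S n p q F \<le> expect2 S n p q G"
  unfolding expect2_def using assms by (intro expect_mono) auto

lemma expect2_variance:
  assumes "sum p S = 1" "sum q S = 1"
    and \<mu>: "expect2 S n p q (\<lambda>x y. expect2 S n p q (F x y)) = \<mu>"
  shows "expect2 S n p q (\<lambda>x y. expect2 S n p q (\<lambda>x' y'. (F x y x' y' - \<mu>)\<^sup>2))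
    = expect2 S n p q (\<lambda>x y. expect2 S n p q (\<lambda>x' y'. (F x y x' y')\<^sup>2)) - \<mu>\<^sup>2"
proof -
  have const: "expect2 S n p q (\<lambda>_ _. c) = c" for c
    unfolding expect2_def using assms by (simp add: expect_const)
  have inner: "expect2 S n p q (\<lambda>x' y'. (F x y x' y' - \<mu>)\<^sup>2)
    = expect2 S n p q (\<lambda>x' y'. (F x y x' y')\<^sup>2) + ((- 2 * \<mu>) * expect2 S n p q (F x y) + \<mu>\<^sup>2)" for x y
  proof -
    have eq: "(F x y x' y' - \<mu>)\<^sup>2 = (F x y x' y')\<^sup>2 + ((- 2 * \<mu>) * F x y x' y' + \<mu>\<^sup>2)" for x' y'
      by (simp add: power2_eq_square algebra_simps)
    show ?thesis by (simp only: eq expect2_add expect2_cmult const)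
  qed
  show ?thesis
    by (simp only: inner expect2_add expect2_cmult const \<mu>) (simp add: power2_eq_square)
qed

text \<open>Linearity of the pairing, with the test function expanded in indicators of points. The
  cut-off to \<open>S\<close> appears because the lists are arbitrary and an entry outside
  \<open>S\<close> matches no \<open>s\<close>.\<close>

lemma sum_sample_diff:
  assumes "finite S"
  shows "(\<Sum>s\<in>S. c s * sample_diff (\<lambda>a. of_bool (a = s)) xs ys)
    = sample_diff (\<lambda>a. if a \<in> S then c a else 0) xs ys"
proof -
  have "(\<Sum>s\<in>S. c s * sum_list (map (\<lambda>a. of_bool (a = s)) zs))
      = sum_list (map (\<lambda>a. if a \<in> S then c a else 0) zs)" for zs
  proof (induction zs)
    case (Cons z zs)
    have "(\<Sum>s\<in>S. c s * of_bool (z = s)) = (if z \<in> S then c z else 0)"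
      using assms by (simp add: of_bool_def if_distrib[of "\<lambda>x. _ * x"] cong: if_cong)
    with Cons show ?case by (simp add: distrib_left sum.distrib)
  qed simp
  then show ?thesis by (simp add: sample_diff_def right_diff_distrib sum_subtractf)
qed

text \<open>Given the first batch, the statistic is a linear statistic of the second batch whose
  test function is the first count difference \<open>G\<close>. Its conditional second moment is at
  most n times the \<open>r\<close>-weighted sum of G^2 plus n^2 times the squared pairing of
  \<open>d\<close> with \<open>G\<close>. That pairing is again a linear statistic of the first
  batch, so one moment bound is used at both levels.\<close>

lemma collision_stat_variance:
  fixes p q :: "'a \<Rightarrow> real" and n :: nat and \<beta> D :: real
  assumes S: "finite S" and p: "prob_weights S p" and q: "prob_weights S q"
    and \<beta>: "\<forall>a\<in>S. p a \<le> \<beta> \<and> q a \<le> \<beta>"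
  defines "D \<equiv> \<Sum>a\<in>S. (p a - q a)\<^sup>2"
  shows "expect S (replicate (2 * n) p @ replicate (2 * n) q)
      (\<lambda>xs. (collision_stat n xs - n\<^sup>2 * D)\<^sup>2) \<le> 4 * \<beta> * n\<^sup>2 + 4 * \<beta> * n ^ 3 * D"
proof -
  define d where "d = (\<lambda>a. p a - q a)"
  define r where "r = (\<lambda>a. p a + q a)"
  define \<phi> where "\<phi> = (\<lambda>(s :: 'a) a. of_bool (a = s) :: real)"
  define G where "G = (\<lambda>x y s. sample_diff (\<phi> s) x y)"
  define d0 where "d0 = (\<lambda>a. if a \<in> S then d a else 0)"
  let ?E = "expect2 S n p q"
  have p1: "sum p S = 1" and q1: "sum q S = 1" and p0: "\<forall>a\<in>S. 0 \<le> p a" and q0: "\<forall>a\<in>S. 0 \<le> q a"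
    using p q by (auto simp: prob_weights_def)
  have r0: "0 \<le> r a" and r\<beta>: "r a \<le> 2 * \<beta>" if "a \<in> S" for a
    using that p0 q0 \<beta> by (force simp: r_def)+
  have D: "D = (\<Sum>a\<in>S. (d a)\<^sup>2)" and D0: "0 \<le> D" by (auto simp: D_def d_def sum_nonneg)
  have delta: "(\<Sum>a\<in>S. f a * \<phi> s a) = f s" "(\<Sum>a\<in>S. f a * (\<phi> s a)\<^sup>2) = f s" if "s \<in> S" for f s
    using S that by (simp_all add: \<phi>_def of_bool_def if_distrib[of "\<lambda>x. _ * x"]
        if_distrib[of "\<lambda>x. x\<^sup>2"] cong: if_cong)
  have EG: "?E (\<lambda>x y. G x y s) = n * d s" if "s \<in> S" for s
    using expect2_sample_diff[OF p1 q1, of n "\<phi> s"] delta(1)[OF that, of d] by (simp add: G_def d_def)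
  have EG2: "?E (\<lambda>x y. (G x y s)\<^sup>2) \<le> n * r s + n\<^sup>2 * (d s)\<^sup>2" if "s \<in> S" for s
    using expect2_sample_diff_square[OF p1 q1, of n "\<phi> s"] delta(1)[OF that, of d] delta(2)[OF that, of r]
    by (simp add: G_def d_def r_def power_mult_distrib)
  have dG: "(\<Sum>s\<in>S. d s * G x y s) = sample_diff d0 x y" for x y
    using sum_sample_diff[OF S, of d] by (simp add: G_def \<phi>_def d0_def)
  \<comment> \<open>In this bound and the next the cap enters, through \<open>r\<close> \<le> 2
    \<beta>; the total weight of \<open>r\<close> is 2.\<close>
  have rd: "(\<Sum>a\<in>S. r a * (d a)\<^sup>2) \<le> 2 * \<beta> * D"
    unfolding D sum_distrib_left using r\<beta> by (intro sum_mono mult_right_mono) auto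
  have rr: "(\<Sum>a\<in>S. r a * r a) \<le> 4 * \<beta>"
  proof -
    have "(\<Sum>a\<in>S. r a * r a) \<le> (\<Sum>a\<in>S. 2 * \<beta> * r a)"
      using r\<beta> r0 by (intro sum_mono mult_right_mono) auto
    also have "\<dots> = 4 * \<beta>" using p1 q1 by (simp add: r_def sum.distrib flip: sum_distrib_left)
    finally show ?thesis .
  qed
  have Ed0: "?E (sample_diff d0) = n * D"
    using expect2_sample_diff[OF p1 q1, of n d0] by (simp add: D d0_def d_def power2_eq_square)
  have Ed02: "?E (\<lambda>x y. (sample_diff d0 x y)\<^sup>2) \<le> n * (2 * \<beta> * D) + (n * D)\<^sup>2"
  proof -
    have "?E (\<lambda>x y. (sample_diff d0 x y)\<^sup>2) \<le> n * (\<Sum>a\<in>S. r a * (d a)\<^sup>2) + (n * D)\<^sup>2"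
      using expect2_sample_diff_square[OF p1 q1, of n d0]
      by (simp add: D d0_def d_def r_def power2_eq_square)
    moreover have "n * (\<Sum>a\<in>S. r a * (d a)\<^sup>2) \<le> n * (2 * \<beta> * D)"
      using rd by (intro mult_left_mono) auto
    ultimately show ?thesis by linarith
  qed
  let ?Z = "\<lambda>x y. sample_diff (G x y)"
  have EZ: "?E (?Z x y) = n * sample_diff d0 x y" for x y
    using expect2_sample_diff[OF p1 q1, of n "G x y"] dG[unfolded d_def] by simp
  have mean: "?E (\<lambda>x y. ?E (?Z x y)) = n\<^sup>2 * D"
    unfolding EZ expect2_cmult Ed0 by (simp add: power2_eq_square)
  have square: "?E (\<lambda>x y. ?E (\<lambda>x' y'. (?Z x y x' y')\<^sup>2))
      \<le> 4 * \<beta> * n\<^sup>2 + 4 * \<beta> * n ^ 3 * D + (n\<^sup>2 * D)\<^sup>2"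
  proof -
    have "?E (\<lambda>x y. ?E (\<lambda>x' y'. (?Z x y x' y')\<^sup>2))
      \<le> ?E (\<lambda>x y. n * (\<Sum>a\<in>S. r a * (G x y a)\<^sup>2) + n\<^sup>2 * (sample_diff d0 x y)\<^sup>2)"
    proof (rule expect2_mono[OF p q])
      fix x y
      show "?E (\<lambda>x' y'. (?Z x y x' y')\<^sup>2)
          \<le> n * (\<Sum>a\<in>S. r a * (G x y a)\<^sup>2) + n\<^sup>2 * (sample_diff d0 x y)\<^sup>2"
        using expect2_sample_diff_square[OF p1 q1, of n "G x y"]
        by (simp add: r_def power_mult_distrib dG[unfolded d_def])
    qed
    also have "\<dots> = n * (\<Sum>a\<in>S. r a * ?E (\<lambda>x y. (G x y a)\<^sup>2)) + n\<^sup>2 * ?E (\<lambda>x y. (sample_diff d0 x y)\<^sup>2)"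
      by (simp add: expect2_add expect2_cmult expect2_sum[OF S])
    also have "\<dots> \<le> n * (\<Sum>a\<in>S. r a * (n * r a + n\<^sup>2 * (d a)\<^sup>2)) + n\<^sup>2 * (n * (2 * \<beta> * D) + (n * D)\<^sup>2)"
      using EG2 r0 Ed02 by (intro add_mono mult_left_mono sum_mono) auto
    finally have 1: "?E (\<lambda>x y. ?E (\<lambda>x' y'. (?Z x y x' y')\<^sup>2))
      \<le> n * (\<Sum>a\<in>S. r a * (n * r a + n\<^sup>2 * (d a)\<^sup>2)) + n\<^sup>2 * (n * (2 * \<beta> * D) + (n * D)\<^sup>2)" .
    have "(\<Sum>a\<in>S. r a * (n * r a + n\<^sup>2 * (d a)\<^sup>2))
        \<le> n * (4 * \<beta>) + n\<^sup>2 * (2 * \<beta> * D)"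
    proof -
      have "(\<Sum>a\<in>S. r a * (n * r a + n\<^sup>2 * (d a)\<^sup>2))
          = n * (\<Sum>a\<in>S. r a * r a) + n\<^sup>2 * (\<Sum>a\<in>S. r a * (d a)\<^sup>2)"
        by (simp add: distrib_left sum.distrib sum_distrib_left mult_ac)
      also have "\<dots> \<le> n * (4 * \<beta>) + n\<^sup>2 * (2 * \<beta> * D)"
        using rr rd by (intro add_mono mult_left_mono) auto
      finally show ?thesis .
    qed
    then have 2: "n * (\<Sum>a\<in>S. r a * (n * r a + n\<^sup>2 * (d a)\<^sup>2))
        \<le> n * (n * (4 * \<beta>) + n\<^sup>2 * (2 * \<beta> * D))"
      by (intro mult_left_mono) auto
    \<comment> \<open>Each batch contributes 2 \<beta> n^3 D, and the last summand is the squared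
      mean that the variance subtracts.\<close>
    have 3: "n * (n * (4 * \<beta>) + n\<^sup>2 * (2 * \<beta> * D)) + n\<^sup>2 * (n * (2 * \<beta> * D) + (n * D)\<^sup>2)
        = 4 * \<beta> * n\<^sup>2 + 4 * \<beta> * n ^ 3 * D + (n\<^sup>2 * D)\<^sup>2"
      by (simp add: power2_eq_square power3_eq_cube algebra_simps)
    show ?thesis by (rule order_trans[OF 1 order_trans[OF add_right_mono[OF 2] eq_refl[OF 3]]])
  qed
  have "expect S (replicate (2 * n) p @ replicate (2 * n) q) (\<lambda>xs. (collision_stat n xs - n\<^sup>2 * D)\<^sup>2)
    = ?E (\<lambda>x y. ?E (\<lambda>x' y'. (?Z x y x' y' - n\<^sup>2 * D)\<^sup>2))"
    using expect_collision[of S n p q "\<lambda>z. (z - n\<^sup>2 * D)\<^sup>2"] by (simp add: G_def[abs_def] \<phi>_def)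
  then show ?thesis using square expect2_variance[OF p1 q1 mean] by linarith
qed

text \<open>Threshold at half the least mean value under the alternative.\<close>

definition collision_test :: "nat \<Rightarrow> real \<Rightarrow> 'a list \<Rightarrow> bool" where
  "collision_test n \<theta> xs \<longleftrightarrow> collision_stat n xs < n\<^sup>2 * \<theta> / 2"

text \<open>A wrong answer forces a deviation of half of n^2 \<theta> from the mean 0 when
  \<open>p = q\<close>, and of half the mean n^2 D otherwise. Chebyshev then bounds the error by 16
  \<beta> / (n \<theta>)^2, respectively by 16 \<beta> / (n D)^2 + 16 \<beta> / (n D).\<close>

lemma collision_test_correct:
  fixes p q :: "'a \<Rightarrow> real" and n :: nat and \<beta> \<theta> :: real
  assumes S: "finite S" and p: "prob_weights S p" and q: "prob_weights S q"
    and \<beta>: "\<forall>a\<in>S. p a \<le> \<beta> \<and> q a \<le> \<beta>" and \<beta>0: "0 < \<beta>" "\<beta> \<le> 1"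
    and \<theta>: "0 < \<theta>" and n: "n * \<theta> \<ge> 100 * sqrt \<beta>"
  shows "p = q \<Longrightarrow> expect S (replicate (2 * n) p @ replicate (2 * n) q)
      (\<lambda>xs. of_bool (collision_test n \<theta> xs)) \<ge> 2 / 3"
    and "(\<Sum>a\<in>S. (p a - q a)\<^sup>2) \<ge> \<theta> \<Longrightarrow> expect S (replicate (2 * n) p @ replicate (2 * n) q)
      (\<lambda>xs. of_bool (\<not> collision_test n \<theta> xs)) \<ge> 2 / 3"
proof -
  have pq: "\<forall>r\<in>set (replicate (2 * n) p @ replicate (2 * n) q). prob_weights S r"
    using p q by auto
  have n0: "0 < real n"
    using n \<theta> \<beta>0(1) by (metis gr0I mult_zero_left not_less of_nat_0 of_nat_0_less_iff mult_pos_pos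
        real_sqrt_gt_0_iff zero_less_numeral)
  have sq: "10000 * \<beta> \<le> (n * t)\<^sup>2" if "\<theta> \<le> t" for t :: real
  proof -
    have "100 * sqrt \<beta> \<le> n * t"
      using n mult_left_mono[OF that, of n] by simp
    then have "(100 * sqrt \<beta>)\<^sup>2 \<le> (n * t)\<^sup>2"
      using \<beta>0 by (intro power_mono) auto
    then show ?thesis using \<beta>0 by (simp add: power_mult_distrib)
  qed
  \<comment> \<open>The constant 100 makes this at most 16 / 10000. Added to the 16 / 100 of the
    other variance term it stays below 1 / 3.\<close>
  have first: "4 * \<beta> * n\<^sup>2 / (n\<^sup>2 * t / 2)\<^sup>2 \<le> 1 / 600" if "\<theta> \<le> t" for t :: real
  proof -
    have "4 * \<beta> * n\<^sup>2 / (n\<^sup>2 * t / 2)\<^sup>2 = 16 * \<beta> / (n * t)\<^sup>2"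
      using n0 by (simp add: field_simps power2_eq_square)
    also have "\<dots> \<le> 1 / 600"
      using sq[OF that] n0 that \<theta> \<beta>0 by (simp add: field_simps)
    finally show ?thesis .
  qed
  {
    assume "p = q"
    have "expect S (replicate (2 * n) p @ replicate (2 * n) q) (\<lambda>xs. of_bool (collision_test n \<theta> xs))
        \<ge> 1 - 4 * \<beta> * n\<^sup>2 / (n\<^sup>2 * \<theta> / 2)\<^sup>2"
    proof (rule expect_chebyshev[OF pq, where \<mu> = 0 and Z = "collision_stat n"])
      show "expect S (replicate (2 * n) p @ replicate (2 * n) q) (\<lambda>xs. (collision_stat n xs - 0)\<^sup>2)
          \<le> 4 * \<beta> * n\<^sup>2"
        using collision_stat_variance[OF S p q \<beta>, of n] \<open>p = q\<close> by simp
    next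
      fix xs :: "'a list"
      assume "\<not> collision_test n \<theta> xs"
      then show "n\<^sup>2 * \<theta> / 2 \<le> \<bar>collision_stat n xs - 0\<bar>"
        unfolding collision_test_def of_nat_power by linarith
    qed (use n0 \<theta> in simp)
    then show "expect S (replicate (2 * n) p @ replicate (2 * n) q)
      (\<lambda>xs. of_bool (collision_test n \<theta> xs)) \<ge> 2 / 3"
      using first[of \<theta>] by simp
  }
  {
    define D where "D = (\<Sum>a\<in>S. (p a - q a)\<^sup>2)"
    assume "(\<Sum>a\<in>S. (p a - q a)\<^sup>2) \<ge> \<theta>"
    then have D: "\<theta> \<le> D" "0 < D" using \<theta> by (auto simp: D_def)
    have "expect S (replicate (2 * n) p @ replicate (2 * n) q) (\<lambda>xs. of_bool (\<not> collision_test n \<theta> xs))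
        \<ge> 1 - (4 * \<beta> * n\<^sup>2 + 4 * \<beta> * n ^ 3 * D) / (n\<^sup>2 * D / 2)\<^sup>2"
    proof (rule expect_chebyshev[OF pq, where \<mu> = "n\<^sup>2 * D" and Z = "collision_stat n"])
      fix xs :: "'a list"
      assume "\<not> \<not> collision_test n \<theta> xs"
      then have "collision_stat n xs < n\<^sup>2 * \<theta> / 2"
        by (simp add: collision_test_def)
      moreover have "n\<^sup>2 * \<theta> \<le> n\<^sup>2 * D" using D by (intro mult_left_mono) auto
      ultimately show "n\<^sup>2 * D / 2 \<le> \<bar>collision_stat n xs - n\<^sup>2 * D\<bar>"
        by linarith
    next
      show "expect S (replicate (2 * n) p @ replicate (2 * n) q) (\<lambda>xs. (collision_stat n xs - n\<^sup>2 * D)\<^sup>2)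
          \<le> 4 * \<beta> * n\<^sup>2 + 4 * \<beta> * n ^ 3 * D"
        using collision_stat_variance[OF S p q \<beta>, of n] unfolding D_def .
    qed (use n0 D in simp)
    moreover have "4 * \<beta> * n ^ 3 * D / (n\<^sup>2 * D / 2)\<^sup>2 \<le> 16 / 100"
    proof -
      \<comment> \<open>The second variance term is linear in 1 / (n D), so it needs n D compared
        with \<beta> itself; \<beta> \<le> 1 gives this from the comparison with sqrt
        \<beta>.\<close>
      have "\<beta> \<le> sqrt \<beta>" using \<beta>0 by (simp add: real_le_rsqrt power2_eq_square mult_left_le)
      also have "100 * sqrt \<beta> \<le> n * D"
        using n mult_left_mono[OF D(1), of n] by simp
      finally have *: "100 * \<beta> \<le> n * D" by simp
      have "4 * \<beta> * n ^ 3 * D / (n\<^sup>2 * D / 2)\<^sup>2 = 16 * \<beta> / (n * D)"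
        using n0 D by (simp add: field_simps power2_eq_square power3_eq_cube)
      also have "\<dots> \<le> 16 / 100" using * n0 D by (simp add: field_simps)
      finally show ?thesis .
    qed
    ultimately show "expect S (replicate (2 * n) p @ replicate (2 * n) q)
      (\<lambda>xs. of_bool (\<not> collision_test n \<theta> xs)) \<ge> 2 / 3"
      using first[OF D(1)] by (simp add: add_divide_distrib)
  }
qed

section \<open>Positive semidefinite matrices and the trace norm\<close>

lemma complex_nonneg_iff: "0 \<le> z \<longleftrightarrow> 0 \<le> Re z \<and> Im z = 0"
  by (auto simp: less_eq_complex_def)

lemma mat_adjoint_index:
  fixes A :: "complex mat"
  shows "i < dim_col A \<Longrightarrow> j < dim_row A \<Longrightarrow> mat_adjoint A $$ (i, j) = cnj (A $$ (j, i))"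
  by (simp add: mat_adjoint_def mat_of_rows_def)

lemma mat_adjoint_dim [simp]: "dim_row (mat_adjoint A) = dim_col A" "dim_col (mat_adjoint A) = dim_row A"
  by (simp_all add: mat_adjoint_def)

lemma mat_adjoint_carrier: "A \<in> carrier_mat n m \<Longrightarrow> mat_adjoint A \<in> carrier_mat m n"
  by auto

lemma mult_mat_index_sum:
  "i < dim_row A \<Longrightarrow> j < dim_col B \<Longrightarrow> dim_col A = dim_row B \<Longrightarrow>
    (A * B) $$ (i, j) = (\<Sum>k<dim_col A. A $$ (i, k) * B $$ (k, j))"
  by (simp add: scalar_prod_def atLeast0LessThan)

lemma quadratic_form_eq_sum:
  assumes "A \<in> carrier_mat n n" "v \<in> carrier_vec n"
  shows "(A *\<^sub>v v) \<bullet>c v = (\<Sum>i<n. \<Sum>j<n. A $$ (i, j) * v $ j * cnj (v $ i))"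
  using assms by (simp add: scalar_prod_def atLeast0LessThan sum_distrib_right)

text \<open>Test vectors become plain functions on indices, so that special ones can be written as
  lambda terms without carrier conditions.\<close>

lemma positive_semidefinite_iff:
  "positive_semidefinite n A \<longleftrightarrow>
    A \<in> carrier_mat n n \<and> (\<forall>u. 0 \<le> (\<Sum>i<n. \<Sum>j<n. A $$ (i, j) * u j * cnj (u i)))"
proof (intro iffI conjI allI)
  assume psd: "positive_semidefinite n A"
  then show "A \<in> carrier_mat n n" by (simp add: positive_semidefinite_def)
  fix u :: "nat \<Rightarrow> complex"
  have "0 \<le> (A *\<^sub>v vec n u) \<bullet>c vec n u"
    using psd by (simp add: positive_semidefinite_def)
  then show "0 \<le> (\<Sum>i<n. \<Sum>j<n. A $$ (i, j) * u j * cnj (u i))"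
    using \<open>A \<in> carrier_mat n n\<close> by (subst (asm) quadratic_form_eq_sum[of _ n]) auto
next
  assume *: "A \<in> carrier_mat n n \<and> (\<forall>u. 0 \<le> (\<Sum>i<n. \<Sum>j<n. A $$ (i, j) * u j * cnj (u i)))"
  show "positive_semidefinite n A"
    unfolding positive_semidefinite_def
  proof (intro conjI ballI)
    fix v :: "complex vec"
    assume "v \<in> carrier_vec n"
    then show "0 \<le> (A *\<^sub>v v) \<bullet>c v"
      using * by (subst quadratic_form_eq_sum[of _ n]) auto
  qed (use * in blast)
qed

text \<open>Polarisation: the form is real at the unit vectors, so the diagonal is real, and at e_i
  + c e_j, where c = 1 compares the imaginary parts of the two entries and c = \<i> their real
  parts.\<close>

lemma positive_semidefinite_hermitian:
  assumes "positive_semidefinite n A" "i < n" "j < n"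
  shows "A $$ (j, i) = cnj (A $$ (i, j))"
proof -
  have pos: "0 \<le> (\<Sum>i<n. \<Sum>j<n. A $$ (i, j) * u j * cnj (u i))" for u
    using assms(1) by (simp add: positive_semidefinite_iff)
  have diag: "Im (A $$ (k, k)) = 0" if "k < n" for k
  proof -
    have "(\<Sum>i<n. \<Sum>j<n. A $$ (i, j) * of_bool (j = k) * cnj (of_bool (i = k))) = A $$ (k, k)"
      unfolding sum_distrib_right[symmetric]
      using that by (simp add: of_bool_def if_distrib[of "\<lambda>x. _ * x"] if_distrib[of cnj] cong: if_cong)
    then show ?thesis using pos[of "\<lambda>l. of_bool (l = k)"] by (simp add: complex_nonneg_iff)
  qed
  show ?thesis
  proof (cases "i = j")
    case True
    then show ?thesis using diag[OF assms(2)] by (simp add: complex_eq_iff)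
  next
    case False
    have "0 \<le> A $$ (i, i) + A $$ (i, j) * c + (A $$ (j, i) * cnj c + A $$ (j, j) * c * cnj c)" for c
    proof -
      let ?u = "\<lambda>k. if k = i then 1 else if k = j then c else 0"
      have *: "(\<Sum>k<n. f k * ?u k) = f i + f j * c" for f
      proof -
        have "(\<Sum>k<n. f k * ?u k) = (\<Sum>k<n. (if k = i then f i else 0) + (if k = j then f j * c else 0))"
          using False by (intro sum.cong) auto
        then show ?thesis using assms by (simp add: sum.distrib)
      qed
      have **: "(\<Sum>k<n. f k * cnj (?u k)) = f i + f j * cnj c" for f
      proof -
        have "(\<Sum>k<n. f k * cnj (?u k)) = (\<Sum>k<n. (if k = i then f i else 0) + (if k = j then f j * cnj c else 0))"
          using False by (intro sum.cong) auto
        then show ?thesis using assms by (simp add: sum.distrib)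
      qed
      have "(\<Sum>k<n. \<Sum>l<n. A $$ (k, l) * ?u l * cnj (?u k))
          = A $$ (i, i) + A $$ (i, j) * c + (A $$ (j, i) + A $$ (j, j) * c) * cnj c"
        unfolding sum_distrib_right[symmetric] * ** ..
      then show ?thesis using pos[of ?u] by (simp add: algebra_simps)
    qed
    from this[of 1] this[of \<i>] show ?thesis
      using diag[OF assms(2)] diag[OF assms(3)] by (simp add: complex_nonneg_iff complex_eq_iff)
  qed
qed

text \<open>The difference of the two sides is half the sum of the values of the quadratic form at
  the vectors \<open>cnj (v j) e_i - cnj (v i) e_j\<close>.\<close>

lemma positive_semidefinite_le_trace:
  assumes "positive_semidefinite n A"
  shows "(\<Sum>i<n. \<Sum>j<n. A $$ (i, j) * v j * cnj (v i))
    \<le> of_real (\<Sum>i<n. (cmod (v i))\<^sup>2) * (\<Sum>i<n. A $$ (i, i))"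
proof -
  define q where "q = (\<Sum>i<n. \<Sum>j<n. A $$ (i, j) * v j * cnj (v i))"
  define N where "N = (\<Sum>i<n. v i * cnj (v i))"
  define T where "T = (\<Sum>i<n. A $$ (i, i))"
  have pos: "0 \<le> (\<Sum>i<n. \<Sum>j<n. A $$ (i, j) * u j * cnj (u i))" for u
    using assms by (simp add: positive_semidefinite_iff)
  have pair: "0 \<le> A $$ (k, k) * (v l * cnj (v l)) + A $$ (l, l) * (v k * cnj (v k))
      - A $$ (k, l) * v l * cnj (v k) - A $$ (l, k) * v k * cnj (v l)" if "k < n" "l < n" for k l
  proof -
    let ?u = "\<lambda>i. (if i = k then cnj (v l) else 0) - (if i = l then cnj (v k) else 0)"
    have *: "(\<Sum>i<n. f i * ?u i) = f k * cnj (v l) - f l * cnj (v k)" for f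
      using that by (simp add: right_diff_distrib sum_subtractf if_distrib[of "\<lambda>x. _ * x"] cong: if_cong)
    have **: "(\<Sum>i<n. f i * cnj (?u i)) = f k * v l - f l * v k" for f
      using that by (simp add: right_diff_distrib sum_subtractf if_distrib[of cnj] if_distrib[of "\<lambda>x. _ * x"] cong: if_cong)
    have "(\<Sum>i<n. \<Sum>j<n. A $$ (i, j) * ?u j * cnj (?u i))
      = (A $$ (k, k) * cnj (v l) - A $$ (k, l) * cnj (v k)) * v l
        - (A $$ (l, k) * cnj (v l) - A $$ (l, l) * cnj (v k)) * v k"
      unfolding sum_distrib_right[symmetric] * ** ..
    also have "\<dots> = A $$ (k, k) * (v l * cnj (v l)) + A $$ (l, l) * (v k * cnj (v k))
      - A $$ (k, l) * v l * cnj (v k) - A $$ (l, k) * v k * cnj (v l)"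
      by (simp add: algebra_simps)
    finally show ?thesis using pos[of ?u] by simp
  qed
  have "0 \<le> (\<Sum>k<n. \<Sum>l<n. A $$ (k, k) * (v l * cnj (v l)) + A $$ (l, l) * (v k * cnj (v k))
      - A $$ (k, l) * v l * cnj (v k) - A $$ (l, k) * v k * cnj (v l))"
    using pair by (intro sum_nonneg) auto
  also have "\<dots> = 2 * (N * T - q)"
  proof -
    have "(\<Sum>k<n. \<Sum>l<n. A $$ (k, k) * (v l * cnj (v l))) = N * T"
      unfolding N_def T_def sum_product by (subst sum.swap) (simp add: mult_ac)
    moreover have "(\<Sum>k<n. \<Sum>l<n. A $$ (l, l) * (v k * cnj (v k))) = N * T"
      unfolding N_def T_def sum_product by (simp add: mult_ac)
    moreover have "(\<Sum>k<n. \<Sum>l<n. A $$ (l, k) * v k * cnj (v l)) = q"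
      unfolding q_def by (rule sum.swap)
    ultimately show ?thesis by (simp add: sum.distrib sum_subtractf q_def)
  qed
  finally have "0 \<le> N * T - q" by (simp add: complex_nonneg_iff)
  moreover have "N = of_real (\<Sum>i<n. (cmod (v i))\<^sup>2)"
    by (simp add: N_def complex_norm_square flip: of_real_power)
  ultimately show ?thesis by (simp add: q_def T_def)
qed

section \<open>Splitting off eigenvectors and a positive root\<close>

text \<open>Gram-Schmidt applied to a basis headed by \<open>v\<close> keeps \<open>v\<close> in
  front. It yields orthogonal but not normalised vectors; the columns are rescaled to length 1,
  whence the scalar in front of \<open>v\<close>.\<close>

lemma unitary_completion:
  fixes v :: "complex vec"
  assumes v: "v \<in> carrier_vec n" "v \<noteq> 0\<^sub>v n"
  shows "\<exists>U \<in> carrier_mat n n. mat_adjoint U * U = 1\<^sub>m n \<and> (\<exists>c. col U 0 = c \<cdot>\<^sub>v v)"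
proof -
  interpret cof_vec_space n "TYPE(complex)" .
  have n: "n \<noteq> 0" using v by (metis carrier_vecD eq_vecI index_zero_vec(2) less_nat_zero_code)
  define b where "b = basis_completion v"
  define ws where "ws = gram_schmidt n b"
  from basis_completion[OF v, folded b_def]
  have dist_b: "distinct b" and indep: "\<not> lin_dep (set b)" and b: "set b \<subseteq> carrier_vec n"
    and hdb: "hd b = v" and len_b: "length b = n" by auto
  from hdb len_b n obtain vs where bv: "b = v # vs" by (cases b) auto
  from gram_schmidt_result[OF b dist_b indep refl, folded ws_def]
  have ws: "set ws \<subseteq> carrier_vec n" "corthogonal ws" "length ws = n" by (auto simp: len_b)
  from gram_schmidt_hd[OF v(1), of vs, folded bv] have "hd ws = v" unfolding ws_def .
  then have ws0: "ws ! 0 = v" using ws n by (cases ws) auto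
  define c where "c = (\<lambda>w. complex_of_real (1 / sqrt (Re (w \<bullet>c w))))" for w :: "complex vec"
  define U where "U = mat_of_cols n (map (\<lambda>w. c w \<cdot>\<^sub>v w) ws)"
  have U: "U \<in> carrier_mat n n" using mat_of_cols_carrier(1)[of n "map (\<lambda>w. c w \<cdot>\<^sub>v w) ws"] ws(3) by (simp add: U_def)
  have wsc: "ws ! i \<in> carrier_vec n" if "i < n" for i using ws that by auto
  have entry: "U $$ (k, i) = c (ws ! i) * ws ! i $ k" if "i < n" "k < n" for i k
    using that ws wsc[OF that(1)] by (simp add: U_def mat_of_cols_index)
  have "mat_adjoint U * U = 1\<^sub>m n"
  proof (rule eq_matI)
    fix i j assume ij: "i < dim_row (1\<^sub>m n)" "j < dim_col (1\<^sub>m n)"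
    then have i: "i < n" and j: "j < n" by auto
    have "(mat_adjoint U * U) $$ (i, j) = (\<Sum>k<n. cnj (U $$ (k, i)) * U $$ (k, j))"
      using i j U by (subst mult_mat_index_sum) (auto simp: mat_adjoint_index)
    also have "\<dots> = c (ws ! i) * c (ws ! j) * (\<Sum>k<n. ws ! j $ k * cnj (ws ! i $ k))"
      unfolding sum_distrib_left using i j by (intro sum.cong) (auto simp: entry c_def)
    also have "(\<Sum>k<n. ws ! j $ k * cnj (ws ! i $ k)) = ws ! j \<bullet>c ws ! i"
      using wsc[OF i] by (simp add: scalar_prod_def atLeast0LessThan)
    also have "c (ws ! i) * c (ws ! j) * (ws ! j \<bullet>c ws ! i) = (if i = j then 1 else 0)"
    proof (cases "i = j")
      case True
      define r where "r = ws ! j \<bullet>c ws ! j"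
      have "0 \<le> r" unfolding r_def by (rule conjugate_square_ge_0_vec)
      moreover have "r \<noteq> 0" using corthogonalD[OF ws(2), of j j] ws(3) j by (auto simp: r_def)
      ultimately have r: "r = of_real (Re r)" "0 < Re r"
        by (auto simp: complex_nonneg_iff complex_eq_iff)
      have "1 / sqrt (Re r) * (1 / sqrt (Re r)) * Re r = 1"
        using r(2) by (simp add: field_simps)
      then have "complex_of_real (1 / sqrt (Re r)) * of_real (1 / sqrt (Re r)) * of_real (Re r) = 1"
        by (metis of_real_1 of_real_mult)
      then show ?thesis
        unfolding r(1)[symmetric] True c_def r_def[symmetric] by (simp only: refl if_True)
    next
      case False
      then show ?thesis using corthogonalD[OF ws(2), of j i] ws(3) i j by auto
    qed
    finally show "(mat_adjoint U * U) $$ (i, j) = 1\<^sub>m n $$ (i, j)" using i j by simp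
  qed (use U in auto)
  moreover have "col U 0 = c v \<cdot>\<^sub>v v"
    using n ws ws0 v by (simp add: U_def)
  ultimately show ?thesis using U by blast
qed

lemma mat_adjoint_mult:
  fixes A B :: "complex mat"
  assumes "A \<in> carrier_mat n m" "B \<in> carrier_mat m k"
  shows "mat_adjoint (A * B) = mat_adjoint B * mat_adjoint A"
proof (rule eq_matI)
  fix i j assume "i < dim_row (mat_adjoint B * mat_adjoint A)" "j < dim_col (mat_adjoint B * mat_adjoint A)"
  then have ij: "i < k" "j < n" using assms by auto
  then have "mat_adjoint (A * B) $$ (i, j) = cnj (\<Sum>l<m. A $$ (j, l) * B $$ (l, i))"
    using assms by (subst mat_adjoint_index) (auto simp: mult_mat_index_sum simp del: index_mult_mat(1))
  also have "\<dots> = (mat_adjoint B * mat_adjoint A) $$ (i, j)"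
    using assms ij by (subst mult_mat_index_sum) (auto simp: mat_adjoint_index mult.commute)
  finally show "mat_adjoint (A * B) $$ (i, j) = (mat_adjoint B * mat_adjoint A) $$ (i, j)" .
qed (use assms in auto)

lemma mat_adjoint_adjoint:
  fixes A :: "complex mat"
  shows "mat_adjoint (mat_adjoint A) = A"
  by (rule eq_matI) (auto simp: mat_adjoint_index)

text \<open>The form of the conjugated matrix at \<open>u\<close> is the form of \<open>R\<close> at
  w, the adjoint of \<open>U\<close> applied to \<open>u\<close>. The exchanges of sums only isolate
  w.\<close>

lemma positive_semidefinite_conjugate:
  assumes U: "U \<in> carrier_mat n n" and R: "positive_semidefinite n R"
  shows "positive_semidefinite n (U * R * mat_adjoint U)"
proof -
  have Rc: "R \<in> carrier_mat n n" using R by (simp add: positive_semidefinite_def)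
  have entry: "(U * R * mat_adjoint U) $$ (i, j)
      = (\<Sum>k<n. \<Sum>l<n. U $$ (i, k) * R $$ (k, l) * cnj (U $$ (j, l)))" if "i < n" "j < n" for i j
  proof -
    have "(U * R * mat_adjoint U) $$ (i, j) = (\<Sum>l<n. (\<Sum>k<n. U $$ (i, k) * R $$ (k, l)) * cnj (U $$ (j, l)))"
      using that U Rc
      by (simp add: mult_mat_index_sum mat_adjoint_index del: index_mult_mat(1))
    also have "\<dots> = (\<Sum>k<n. \<Sum>l<n. U $$ (i, k) * R $$ (k, l) * cnj (U $$ (j, l)))"
      unfolding sum_distrib_right by (rule sum.swap)
    finally show ?thesis .
  qed
  have "0 \<le> (\<Sum>i<n. \<Sum>j<n. (U * R * mat_adjoint U) $$ (i, j) * u j * cnj (u i))" for u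
  proof -
    define w where "w = (\<lambda>l. \<Sum>j<n. cnj (U $$ (j, l)) * u j)"
    have "(\<Sum>i<n. \<Sum>j<n. (U * R * mat_adjoint U) $$ (i, j) * u j * cnj (u i))
      = (\<Sum>i<n. \<Sum>j<n. \<Sum>k<n. \<Sum>l<n. R $$ (k, l) * (cnj (U $$ (j, l)) * u j) * (U $$ (i, k) * cnj (u i)))"
      by (intro sum.cong refl) (simp add: entry sum_distrib_left sum_distrib_right mult_ac)
    also have "\<dots> = (\<Sum>i<n. \<Sum>k<n. \<Sum>j<n. \<Sum>l<n. R $$ (k, l) * (cnj (U $$ (j, l)) * u j) * (U $$ (i, k) * cnj (u i)))"
      by (intro sum.cong refl sum.swap)
    also have "\<dots> = (\<Sum>k<n. \<Sum>i<n. \<Sum>j<n. \<Sum>l<n. R $$ (k, l) * (cnj (U $$ (j, l)) * u j) * (U $$ (i, k) * cnj (u i)))"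
      by (rule sum.swap)
    also have "\<dots> = (\<Sum>k<n. \<Sum>i<n. \<Sum>l<n. \<Sum>j<n. R $$ (k, l) * (cnj (U $$ (j, l)) * u j) * (U $$ (i, k) * cnj (u i)))"
      by (intro sum.cong refl sum.swap)
    also have "\<dots> = (\<Sum>k<n. \<Sum>l<n. \<Sum>i<n. \<Sum>j<n. R $$ (k, l) * (cnj (U $$ (j, l)) * u j) * (U $$ (i, k) * cnj (u i)))"
      by (intro sum.cong refl sum.swap)
    also have "\<dots> = (\<Sum>k<n. \<Sum>l<n. R $$ (k, l) * w l * cnj (w k))"
    proof -
      have "cnj (w k) = (\<Sum>i<n. U $$ (i, k) * cnj (u i))" for k
        by (simp add: w_def)
      then show ?thesis
        by (simp only: w_def flip: sum_distrib_left sum_distrib_right)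
    qed
    finally show ?thesis using R by (simp add: positive_semidefinite_iff)
  qed
  then show ?thesis using U Rc by (auto simp: positive_semidefinite_iff)
qed

text \<open>The root is the absolute value of A, built by deflation. In a unitary basis headed by an
  eigenvector, A becomes the direct sum of a real 1 x 1 block and a smaller Hermitian block; take
  the absolute value of the former and recurse on the latter.\<close>

lemma hermitian_square_psd_root:
  fixes A :: "complex mat"
  assumes "A \<in> carrier_mat n n" "mat_adjoint A = A"
  shows "\<exists>R. positive_semidefinite n R \<and> R * R = A * A"
  using assms
proof (induction n arbitrary: A)
  case 0
  then show ?case by (intro exI[of _ A]) (simp add: positive_semidefinite_iff)
next
  case (Suc n)
  let ?n = "Suc n"
  have A: "A \<in> carrier_mat ?n ?n" by fact
  obtain as where as: "char_poly A = (\<Prod>a\<leftarrow>as. [:- a, 1:])" "length as = ?n"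
    using char_poly_factorized[OF A] by blast
  then obtain a where "poly (char_poly A) a = 0" by (cases as) auto
  then obtain v where "eigenvector A v a"
    using eigenvalue_root_char_poly[OF A] unfolding eigenvalue_def by auto
  then have v: "v \<in> carrier_vec ?n" "v \<noteq> 0\<^sub>v ?n" "A *\<^sub>v v = a \<cdot>\<^sub>v v"
    using A by (auto simp: eigenvector_def)
  obtain U c where U: "U \<in> carrier_mat ?n ?n" and UU: "mat_adjoint U * U = 1\<^sub>m ?n"
    and c: "col U 0 = c \<cdot>\<^sub>v v"
    using unitary_completion[OF v(1,2)] by blast
  have U': "mat_adjoint U \<in> carrier_mat ?n ?n" using U by (rule mat_adjoint_carrier)
  have UU': "U * mat_adjoint U = 1\<^sub>m ?n"
    by (rule mat_mult_left_right_inverse[OF U' U UU])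
  define B where "B = mat_adjoint U * (A * U)"
  have B: "B \<in> carrier_mat ?n ?n" using U' A U by (auto simp: B_def)
  have BA: "U * B * mat_adjoint U = A"
  proof -
    have "U * B * mat_adjoint U = (U * mat_adjoint U) * A * (U * mat_adjoint U)"
      unfolding B_def using U U' A by (simp add: assoc_mult_mat[where n\<^sub>1 = ?n and n\<^sub>2 = ?n and n\<^sub>3 = ?n and n\<^sub>4 = ?n])
    then show ?thesis using A by (simp add: UU')
  qed
  have Bherm: "mat_adjoint B = B"
  proof -
    have "mat_adjoint B = (mat_adjoint U * A) * U"
      unfolding B_def using U U' A Suc.prems(2)
      by (simp add: mat_adjoint_mult[where n = ?n and m = ?n and k = ?n] mat_adjoint_adjoint)
    then show ?thesis using U U' A by (simp add: B_def)
  qed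
  have Bcnj: "B $$ (j, i) = cnj (B $$ (i, j))" if "i < ?n" "j < ?n" for i j
    using that B mat_adjoint_index[of j B i] Bherm by auto
  \<comment> \<open>The leading column of \<open>U\<close> is an eigenvector, so the leading column
    of \<open>B\<close> is \<open>a\<close> times that of the identity.\<close>
  have col0: "B $$ (i, 0) = 0" if "i < ?n" "i \<noteq> 0" for i
  proof -
    have AU: "(A * U) $$ (j, 0) = a * U $$ (j, 0)" if "j < ?n" for j
    proof -
      have "(A * U) $$ (j, 0) = (A *\<^sub>v col U 0) $ j"
        using that A U by simp
      also have "A *\<^sub>v col U 0 = a \<cdot>\<^sub>v col U 0"
        unfolding c using A v by (simp add: mult_mat_vec smult_smult_assoc mult.commute)
      also have "(a \<cdot>\<^sub>v col U 0) $ j = a * U $$ (j, 0)"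
        using that U by simp
      finally show ?thesis .
    qed
    have "B $$ (i, 0) = (\<Sum>k<?n. mat_adjoint U $$ (i, k) * (A * U) $$ (k, 0))"
      unfolding B_def using that U A by (subst mult_mat_index_sum) auto
    also have "\<dots> = a * (\<Sum>k<?n. mat_adjoint U $$ (i, k) * U $$ (k, 0))"
      unfolding sum_distrib_left by (intro sum.cong refl) (simp add: AU del: index_mult_mat(1))
    also have "(\<Sum>k<?n. mat_adjoint U $$ (i, k) * U $$ (k, 0)) = (mat_adjoint U * U) $$ (i, 0)"
      using that U by (subst mult_mat_index_sum) auto
    finally show ?thesis using that UU by simp
  qed
  have row0: "B $$ (0, i) = 0" if "i < ?n" "i \<noteq> 0" for i
    using Bcnj[of i 0] col0[OF that] that by simp
  define B' where "B' = mat n n (\<lambda>(i, j). B $$ (Suc i, Suc j))"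
  have B': "B' \<in> carrier_mat n n" by (simp add: B'_def)
  have "mat_adjoint B' = B'"
    by (rule eq_matI) (auto simp: mat_adjoint_index B'_def intro!: Bcnj[symmetric])
  from Suc.IH[OF B' this] obtain R' where R': "positive_semidefinite n R'" "R' * R' = B' * B'"
    by blast
  then have R'c: "R' \<in> carrier_mat n n" by (simp add: positive_semidefinite_def)
  \<comment> \<open>Direct sum of the 1 x 1 block with the recursive root; the index shift by 1
    passes to the smaller block.\<close>
  define R where "R = mat ?n ?n (\<lambda>(i, j). if i = 0 \<and> j = 0 then of_real \<bar>Re (B $$ (0, 0))\<bar>
    else if i = 0 \<or> j = 0 then 0 else R' $$ (i - 1, j - 1))"
  have R: "R \<in> carrier_mat ?n ?n" by (simp add: R_def)
  have Rpsd: "positive_semidefinite ?n R"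
  proof -
    have "0 \<le> (\<Sum>i<?n. \<Sum>j<?n. R $$ (i, j) * u j * cnj (u i))" for u
    proof -
      have "(\<Sum>i<?n. \<Sum>j<?n. R $$ (i, j) * u j * cnj (u i))
        = of_real (\<bar>Re (B $$ (0, 0))\<bar> * (cmod (u 0))\<^sup>2)
          + (\<Sum>i<n. \<Sum>j<n. R' $$ (i, j) * u (Suc j) * cnj (u (Suc i)))"
        by (simp add: R_def sum.lessThan_Suc_shift mult.assoc del: sum.lessThan_Suc flip: complex_norm_square)
      also have "0 \<le> \<dots>"
        using R'(1) unfolding positive_semidefinite_iff
        by (intro add_nonneg_nonneg) (auto simp: complex_nonneg_iff)
      finally show ?thesis .
    qed
    then show ?thesis using R by (simp add: positive_semidefinite_iff)
  qed
  have RR: "R * R = B * B"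
  proof (rule eq_matI)
    fix i j assume "i < dim_row (B * B)" "j < dim_col (B * B)"
    then have i: "i < ?n" and j: "j < ?n" using B by auto
    have 1: "(R * R) $$ (i, j) = (\<Sum>k<?n. R $$ (i, k) * R $$ (k, j))"
      using i j R by (subst mult_mat_index_sum) auto
    have 2: "(B * B) $$ (i, j) = (\<Sum>k<?n. B $$ (i, k) * B $$ (k, j))"
      using i j B by (subst mult_mat_index_sum) auto
    have 3: "(\<Sum>k<n. R' $$ (k1, k) * R' $$ (k, k2)) = (\<Sum>k<n. B $$ (Suc k1, Suc k) * B $$ (Suc k, Suc k2))"
      if "k1 < n" "k2 < n" for k1 k2
    proof -
      have "(\<Sum>k<n. R' $$ (k1, k) * R' $$ (k, k2)) = (R' * R') $$ (k1, k2)"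
        using that R'c by (subst mult_mat_index_sum) auto
      also have "\<dots> = (\<Sum>k<n. B $$ (Suc k1, Suc k) * B $$ (Suc k, Suc k2))"
        unfolding R'(2) using that B' by (subst mult_mat_index_sum) (auto simp: B'_def)
      finally show ?thesis .
    qed
    have B00: "B $$ (0, 0) = of_real (Re (B $$ (0, 0)))"
      using Bcnj[of 0 0] by (simp add: complex_eq_iff)
    have 4: "complex_of_real \<bar>Re (B $$ (0, 0))\<bar> * complex_of_real \<bar>Re (B $$ (0, 0))\<bar> = B $$ (0, 0) * B $$ (0, 0)"
      by (subst (3 4) B00) (simp flip: of_real_mult)
    show "(R * R) $$ (i, j) = (B * B) $$ (i, j)"
      unfolding 1 2 sum.lessThan_Suc_shift using i j 3 4
      by (cases i; cases j) (auto simp: R_def col0 row0)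
  qed (use R B in auto)
  \<comment> \<open>The inner unitary factors cancel, \<open>R * R\<close> is replaced by
    \<open>B * B\<close>, and the same cancellation read backwards returns to A * A.\<close>
  have "(U * R * mat_adjoint U) * (U * R * mat_adjoint U) = U * (R * ((mat_adjoint U * U) * (R * mat_adjoint U)))"
    using U U' R by (simp add: assoc_mult_mat[where n\<^sub>1 = ?n and n\<^sub>2 = ?n and n\<^sub>3 = ?n and n\<^sub>4 = ?n])
  also have "\<dots> = U * ((R * R) * mat_adjoint U)"
    using U U' R by (simp add: UU assoc_mult_mat[where n\<^sub>1 = ?n and n\<^sub>2 = ?n and n\<^sub>3 = ?n and n\<^sub>4 = ?n])
  also have "\<dots> = U * (B * ((mat_adjoint U * U) * (B * mat_adjoint U)))"
    using U U' B by (simp add: UU RR assoc_mult_mat[where n\<^sub>1 = ?n and n\<^sub>2 = ?n and n\<^sub>3 = ?n and n\<^sub>4 = ?n])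
  also have "\<dots> = (U * B * mat_adjoint U) * (U * B * mat_adjoint U)"
    using U U' B by (simp add: assoc_mult_mat[where n\<^sub>1 = ?n and n\<^sub>2 = ?n and n\<^sub>3 = ?n and n\<^sub>4 = ?n])
  finally show ?case
    using positive_semidefinite_conjugate[OF U Rpsd] unfolding BA by blast
qed

text \<open>Cauchy-Schwarz against the constant 1, from the nonnegative sum of all (f i - f
  j)^2.\<close>

lemma sum_square_le_card:
  fixes f :: "nat \<Rightarrow> real"
  shows "(\<Sum>i<n. f i)\<^sup>2 \<le> n * (\<Sum>i<n. (f i)\<^sup>2)"
proof -
  have "0 \<le> (\<Sum>i<n. \<Sum>j<n. (f i - f j)\<^sup>2)" by (intro sum_nonneg) auto
  also have "\<dots> = 2 * (n * (\<Sum>i<n. (f i)\<^sup>2) - (\<Sum>i<n. f i)\<^sup>2)"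
    unfolding power2_diff power2_eq_square[of "sum f {..<n}"] sum_product
    by (simp add: sum.distrib sum_subtractf sum_distrib_left mult.assoc)
  finally show ?thesis by simp
qed

lemma mat_trace_mult:
  assumes "A \<in> carrier_mat n m" "B \<in> carrier_mat m n"
  shows "mat_trace (A * B) = (\<Sum>i<n. \<Sum>j<m. A $$ (i, j) * B $$ (j, i))"
  using assms by (simp add: mat_trace_def mult_mat_index_sum del: index_mult_mat(1))

text \<open>The trace of a root R sees only its n diagonal entries, so its square is at most n
  |R|_F^2. As R and A are Hermitian with equal squares, |R|_F^2 = tr (R R) = tr (A A) = |A|_F^2. The
  argument covers whichever root the choice operator returns.\<close>

lemma trace_norm_le_frobenius:
  assumes A: "A \<in> carrier_mat n n" "mat_adjoint A = A"
  shows "(trace_norm A)\<^sup>2 \<le> n * (\<Sum>i<n. \<Sum>j<n. (cmod (A $$ (i, j)))\<^sup>2)"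
proof -
  define R where "R = psd_sqrt (mat_adjoint A * A)"
  have "\<exists>R. positive_semidefinite (dim_row (mat_adjoint A * A)) R \<and> R * R = mat_adjoint A * A"
    using hermitian_square_psd_root[OF A] A by simp
  from someI_ex[OF this] have R: "positive_semidefinite n R" "R * R = A * A"
    using A by (simp_all add: R_def psd_sqrt_def)
  then have Rc: "R \<in> carrier_mat n n" by (simp add: positive_semidefinite_def)
  have tr: "mat_trace (C * C) = of_real (\<Sum>i<n. \<Sum>j<n. (cmod (C $$ (i, j)))\<^sup>2)"
    if "C \<in> carrier_mat n n" "\<And>i j. i < n \<Longrightarrow> j < n \<Longrightarrow> C $$ (j, i) = cnj (C $$ (i, j))" for C
  proof -
    have "mat_trace (C * C) = (\<Sum>i<n. \<Sum>j<n. C $$ (i, j) * cnj (C $$ (i, j)))"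
      unfolding mat_trace_mult[OF that(1,1)] by (intro sum.cong refl arg_cong2[where f = times] that(2)) auto
    then show ?thesis by (simp flip: complex_norm_square)
  qed
  have "(trace_norm A)\<^sup>2 = (\<Sum>i<n. Re (R $$ (i, i)))\<^sup>2"
    using Rc by (simp add: trace_norm_def mat_trace_def flip: R_def)
  also have "\<dots> \<le> n * (\<Sum>i<n. (Re (R $$ (i, i)))\<^sup>2)"
    by (rule sum_square_le_card)
  also have "\<dots> \<le> n * (\<Sum>i<n. \<Sum>j<n. (cmod (R $$ (i, j)))\<^sup>2)"
  proof (intro mult_left_mono sum_mono)
    fix i assume "i \<in> {..<n}"
    have "(Re (R $$ (i, i)))\<^sup>2 \<le> (cmod (R $$ (i, i)))\<^sup>2"
      by (simp add: abs_Re_le_cmod flip: abs_le_square_iff)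
    also have "\<dots> \<le> (\<Sum>j<n. (cmod (R $$ (i, j)))\<^sup>2)"
      using \<open>i \<in> {..<n}\<close> by (intro member_le_sum) auto
    finally show "(Re (R $$ (i, i)))\<^sup>2 \<le> (\<Sum>j<n. (cmod (R $$ (i, j)))\<^sup>2)" .
  qed simp
  also have "(\<Sum>i<n. \<Sum>j<n. (cmod (R $$ (i, j)))\<^sup>2) = Re (mat_trace (R * R))"
    using tr[OF Rc positive_semidefinite_hermitian[OF R(1)]] by simp
  also have "\<dots> = (\<Sum>i<n. \<Sum>j<n. (cmod (A $$ (i, j)))\<^sup>2)"
  proof -
    have "A $$ (j, i) = cnj (A $$ (i, j))" if "i < n" "j < n" for i j
      using that A mat_adjoint_index[of j A i] by auto
    from tr[OF A(1) this] show ?thesis by (simp add: R(2))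
  qed
  finally show ?thesis .
qed

section \<open>Tensor products\<close>

text \<open>Splits an index as \<open>kronecker\<close> does, quotient for the left factor and
  remainder for the right one; it turns sums over a tensor product into iterated sums.\<close>

lemma sum_lessThan_mult:
  fixes f :: "nat \<Rightarrow> 'a::comm_monoid_add"
  shows "(\<Sum>i<a * b. f i) = (\<Sum>i<a. \<Sum>k<b. f (i * b + k))"
proof -
  have "sum f {i * b..<i * b + b} = (\<Sum>k<b. f (i * b + k))" for i
    using sum.shift_bounds_nat_ivl[of f 0 "i * b" b] by (simp add: atLeast0LessThan add.commute)
  then show ?thesis by (simp flip: sum.nat_group)
qed

lemma kronecker_carrier:
  "A \<in> carrier_mat a b \<Longrightarrow> B \<in> carrier_mat c d \<Longrightarrow> kronecker A B \<in> carrier_mat (a * c) (b * d)"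
  by (auto simp: kronecker_def)

lemma mult_add_less_mult:
  fixes i k a b :: nat
  assumes "i < a" "k < b"
  shows "i * b + k < a * b"
proof -
  have "i * b + k < Suc i * b" using assms(2) by simp
  also have "\<dots> \<le> a * b" using assms(1) by (intro mult_le_mono1) simp
  finally show ?thesis .
qed

lemma kronecker_index:
  assumes "A \<in> carrier_mat a b" "B \<in> carrier_mat c d" "i < a" "k < c" "j < b" "l < d"
  shows "kronecker A B $$ (i * c + k, j * d + l) = A $$ (i, j) * B $$ (k, l)"
  using assms mult_add_less_mult[of i a k c] mult_add_less_mult[of j b l d] by (simp add: kronecker_def)

text \<open>Both sides read the index as the same three mixed-radix digits. Associativity is what
  lets the tensor product of a concatenated list be cut between its parts.\<close>

lemma kronecker_assoc: "kronecker (kronecker A B) C = kronecker A (kronecker B C)"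
proof (rule eq_matI)
  fix i j assume "i < dim_row (kronecker A (kronecker B C))" "j < dim_col (kronecker A (kronecker B C))"
  then have i: "i < dim_row A * (dim_row B * dim_row C)" and j: "j < dim_col A * (dim_col B * dim_col C)"
    by (simp_all add: kronecker_def)
  then have pos: "0 < dim_row B" "0 < dim_row C" "0 < dim_col B" "0 < dim_col C"
    by (auto intro!: Nat.gr0I)
  have i': "i div dim_row C < dim_row A * dim_row B" "i < dim_row A * dim_row B * dim_row C"
    using i by (auto simp: less_mult_imp_div_less mult.assoc)
  have j': "j div dim_col C < dim_col A * dim_col B" "j < dim_col A * dim_col B * dim_col C"
    using j by (auto simp: less_mult_imp_div_less mult.assoc)
  have d: "i div (b * c) = i div c div b" for i b c :: nat
    by (metis div_mult2_eq mult.commute)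
  have m: "i mod (b * c) = c * (i div c mod b) + i mod c" for i b c :: nat
    by (metis mod_mult2_eq mult.commute)
  have m1: "i mod (b * c) div c = i div c mod b" "i mod (b * c) mod c = i mod c" if "0 < c" for i b c :: nat
    using that by (simp_all add: m)
  show "kronecker (kronecker A B) C $$ (i, j) = kronecker A (kronecker B C) $$ (i, j)"
    using i j i' j' pos by (simp add: kronecker_def d m1)
qed (simp_all add: kronecker_def mult.assoc)

lemma kronecker_one_left: "kronecker (1\<^sub>m 1) A = A"
  by (rule eq_matI) (auto simp: kronecker_def)

lemma tensor_list_simps [simp]:
  "tensor_list [] = 1\<^sub>m 1" "tensor_list (A # As) = kronecker A (tensor_list As)"
  by (simp_all add: tensor_list_def)

lemma tensor_list_append: "tensor_list (As @ Bs) = kronecker (tensor_list As) (tensor_list Bs)"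
  by (induction As) (simp_all add: kronecker_assoc kronecker_one_left del: One_nat_def)

lemma tensor_list_carrier:
  "\<forall>A\<in>set As. A \<in> carrier_mat d d \<Longrightarrow> tensor_list As \<in> carrier_mat (d ^ length As) (d ^ length As)"
  by (induction As) (auto intro: kronecker_carrier)

text \<open>The source of independence: the Born weight of a product effect on a product state
  factorises.\<close>

lemma mat_trace_kronecker_mult:
  assumes A: "A \<in> carrier_mat a a" and B: "B \<in> carrier_mat b b"
    and C: "C \<in> carrier_mat a a" and D: "D \<in> carrier_mat b b"
  shows "mat_trace (kronecker A B * kronecker C D) = mat_trace (A * C) * mat_trace (B * D)"
proof -
  have "mat_trace (kronecker A B * kronecker C D)
    = (\<Sum>i<a. \<Sum>k<b. \<Sum>j<a. \<Sum>l<b. (A $$ (i, j) * C $$ (j, i)) * (B $$ (k, l) * D $$ (l, k)))"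
    unfolding mat_trace_mult[OF kronecker_carrier[OF A B] kronecker_carrier[OF C D]] sum_lessThan_mult
    by (intro sum.cong refl) (simp add: kronecker_index[OF A B] kronecker_index[OF C D])
  also have "\<dots> = (\<Sum>i<a. \<Sum>k<b. (\<Sum>j<a. A $$ (i, j) * C $$ (j, i)) * (\<Sum>l<b. B $$ (k, l) * D $$ (l, k)))"
    unfolding sum_product ..
  also have "\<dots> = mat_trace (A * C) * mat_trace (B * D)"
    unfolding mat_trace_mult[OF A C] mat_trace_mult[OF B D] sum_product ..
  finally show ?thesis .
qed

section \<open>Product measurements on independent copies\<close>

lemma outcomes_Nil [simp]: "outcomes [] = {[]}"
  by (simp add: outcomes_def)

lemma outcomes_Cons: "outcomes (Es # Ms) = (\<lambda>(a, x). a # x) ` ({..<length Es} \<times> outcomes Ms)"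
  by (auto simp: outcomes_def set_Cons_def)

lemma sum_outcomes_Cons:
  "(\<Sum>x\<in>outcomes (Es # Ms). f x) = (\<Sum>a<length Es. \<Sum>x\<in>outcomes Ms. f (a # x))"
  unfolding outcomes_Cons
  by (subst sum.reindex) (auto simp: inj_on_def sum.cartesian_product case_prod_unfold)

lemma finite_outcomes: "finite (outcomes Ms)"
  by (induction Ms) (simp_all add: outcomes_Cons)

lemma length_outcomes: "x \<in> outcomes Ms \<Longrightarrow> length x = length Ms"
  by (induction Ms arbitrary: x) (auto simp: outcomes_Cons)

lemma sum_outcomes_append:
  "(\<Sum>x\<in>outcomes (Ms @ Ns). f x) = (\<Sum>x\<in>outcomes Ms. \<Sum>y\<in>outcomes Ns. f (x @ y))"
  by (induction Ms arbitrary: f) (simp_all add: sum_outcomes_Cons)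

lemma effect_Nil [simp]: "effect [] [] = 1\<^sub>m 1"
  by (simp add: effect_def)

lemma effect_Cons: "effect (Es # Ms) (a # x) = kronecker (Es ! a) (effect Ms x)"
  by (simp add: effect_def)

lemma effect_append:
  "length x = length Ms \<Longrightarrow> effect (Ms @ Ns) (x @ y) = kronecker (effect Ms x) (effect Ns y)"
  by (simp add: effect_def tensor_list_append)

lemma effect_carrier:
  assumes "x \<in> outcomes Ms" "\<forall>Es\<in>set Ms. set Es \<subseteq> carrier_mat d d"
  shows "effect Ms x \<in> carrier_mat (d ^ length Ms) (d ^ length Ms)"
  using assms
  by (induction Ms arbitrary: x) (auto simp: outcomes_Cons effect_Cons intro!: kronecker_carrier subsetD[OF _ nth_mem])

text \<open>The Born rule for the same measurement on every copy is a product distribution on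
  per-copy outcomes. The assumption that the traces are real is there because the real part of a
  product factorises when one factor is real.\<close>

lemma sum_effect_tensor:
  assumes Ms: "\<forall>Es\<in>set Ms. set Es \<subseteq> carrier_mat d d"
    and \<omega>: "\<forall>\<omega>\<in>set \<omega>s. \<omega> \<in> carrier_mat (d ^ length Ms) (d ^ length Ms) \<and>
      (\<forall>x\<in>outcomes Ms. Im (mat_trace (effect Ms x * \<omega>)) = 0)"
  shows "(\<Sum>x\<in>outcomes (concat (replicate (length \<omega>s) Ms)).
      Re (mat_trace (effect (concat (replicate (length \<omega>s) Ms)) x * tensor_list \<omega>s)) * F x)
    = expect (outcomes Ms) (map (\<lambda>\<omega> x. Re (mat_trace (effect Ms x * \<omega>))) \<omega>s) (\<lambda>xs. F (concat xs))"
  using \<omega>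
proof (induction \<omega>s arbitrary: F)
  case Nil
  then show ?case by (simp add: mat_trace_def)
next
  case (Cons \<omega> \<omega>s)
  let ?D = "d ^ length Ms"
  let ?Ns = "concat (replicate (length \<omega>s) Ms)"
  have \<omega>: "\<omega> \<in> carrier_mat ?D ?D" and \<omega>s: "\<forall>\<omega>\<in>set \<omega>s. \<omega> \<in> carrier_mat ?D ?D"
    using Cons.prems by auto
  have len: "d ^ length ?Ns = ?D ^ length \<omega>s"
    by (simp add: length_concat sum_list_replicate mult.commute flip: power_mult)
  have step: "Re (mat_trace (effect (Ms @ ?Ns) (x @ y) * tensor_list (\<omega> # \<omega>s)))
      = Re (mat_trace (effect Ms x * \<omega>)) * Re (mat_trace (effect ?Ns y * tensor_list \<omega>s))"
    if x: "x \<in> outcomes Ms" and y: "y \<in> outcomes ?Ns" for x y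
  proof -
    have "effect ?Ns y \<in> carrier_mat (?D ^ length \<omega>s) (?D ^ length \<omega>s)"
      using effect_carrier[OF y, of d] Ms unfolding len by (auto split: if_splits)
    then show ?thesis
      using Cons.prems x mat_trace_kronecker_mult[OF effect_carrier[OF x Ms] _ \<omega> tensor_list_carrier[OF \<omega>s]]
      by (simp add: effect_append length_outcomes)
  qed
  have "(\<Sum>x\<in>outcomes (Ms @ ?Ns). Re (mat_trace (effect (Ms @ ?Ns) x * tensor_list (\<omega> # \<omega>s))) * F x)
    = (\<Sum>x\<in>outcomes Ms. Re (mat_trace (effect Ms x * \<omega>)) *
        (\<Sum>y\<in>outcomes ?Ns. Re (mat_trace (effect ?Ns y * tensor_list \<omega>s)) * F (x @ y)))"
    unfolding sum_outcomes_append sum_distrib_left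
    by (intro sum.cong refl) (simp only: step mult.assoc)
  then show ?case using Cons by simp
qed

text \<open>Recovers per-copy outcomes from the flat string of qubit outcomes. The number of blocks
  is an argument because for blocks of length 0 the string does not determine it.\<close>

fun chunks :: "nat \<Rightarrow> nat \<Rightarrow> 'a list \<Rightarrow> 'a list list" where
  "chunks m 0 xs = []"
| "chunks m (Suc k) xs = take m xs # chunks m k (drop m xs)"

lemma chunks_concat: "\<forall>xs\<in>set xss. length xs = m \<Longrightarrow> chunks m (length xss) (concat xss) = xss"
  by (induction xss) simp_all

section \<open>The tetrahedral measurement\<close>

text \<open>Vectors of the tetrahedral measurement, scaled by \<open>1 / sqrt 2\<close>.\<close>

definition tetra_vec :: "nat \<Rightarrow> nat \<Rightarrow> complex" where
  "tetra_vec a i = (if a = 0 then (if i = 0 then of_real (sqrt (1 / 2)) else 0)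
    else if i = 0 then of_real (sqrt (1 / 6))
    else of_real (sqrt (1 / 3)) * (if a = 1 then Complex (- 1 / 2) (sqrt 3 / 2)
      else if a = 2 then Complex (- 1 / 2) (- sqrt 3 / 2) else 1))"

definition tetra_povm :: "complex mat list" where
  "tetra_povm = map (\<lambda>a. mat 2 2 (\<lambda>(i, j). tetra_vec a i * cnj (tetra_vec a j))) [0..<4]"

lemma tetra_sum: "i < 2 \<Longrightarrow> j < 2 \<Longrightarrow> (\<Sum>a<4. tetra_vec a i * cnj (tetra_vec a j)) = of_bool (i = j)"
  by (auto simp: less_2_cases_iff tetra_vec_def eval_nat_numeral complex_eq_iff)

lemma tetra_norm: "a < 4 \<Longrightarrow> (\<Sum>i<2. (cmod (tetra_vec a i))\<^sup>2) = 1 / 2"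
  by (auto simp: tetra_vec_def eval_nat_numeral cmod_def power_divide)

text \<open>Parseval's identity for the Fourier transform on three points. Three of the tetrahedral
  vectors differ only by a cube root of unity as phase, so their values on a matrix have this
  shape.\<close>

lemma parseval_cube_roots:
  fixes c u v :: complex
  defines "\<omega> \<equiv> Complex (- 1 / 2) (sqrt 3 / 2)"
  shows "(cmod (c + (\<omega> * u + cnj \<omega> * v)))\<^sup>2 + (cmod (c + (cnj \<omega> * u + \<omega> * v)))\<^sup>2 + (cmod (c + (u + v)))\<^sup>2
    = 3 * ((cmod c)\<^sup>2 + (cmod u)\<^sup>2 + (cmod v)\<^sup>2)"
proof -
  \<comment> \<open>Naming the root lets its square be used as a rewrite rule inside
    products.\<close>
  define t where "t = sqrt 3"
  have t: "t * t = 3" "t * (t * x) = 3 * x" for x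
    by (simp_all add: t_def flip: mult.assoc)
  have \<omega>: "Re \<omega> = - 1 / 2" "Im \<omega> = t / 2" by (simp_all add: \<omega>_def t_def)
  show ?thesis
    unfolding cmod_power2
    by (simp add: power2_eq_square \<omega> algebra_simps add_divide_distrib diff_divide_distrib t)
qed

lemma tetra_frobenius_lower:
  fixes b :: "nat \<Rightarrow> nat \<Rightarrow> complex"
  shows "1 / 6 * (\<Sum>i<2. \<Sum>j<2. (cmod (b i j))\<^sup>2)
    \<le> (\<Sum>a<4. (cmod (\<Sum>i<2. \<Sum>j<2. tetra_vec a i * cnj (tetra_vec a j) * b j i))\<^sup>2)"
proof -
  define s where "s = complex_of_real (sqrt (1 / 6) * sqrt (1 / 3))"
  have s: "(cmod s)\<^sup>2 = 1 / 18" by (simp add: s_def norm_mult power_mult_distrib)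
  \<comment> \<open>The diagonal contribution shared by the vectors 1, 2 and 3, whose squared
    entries are 1 / 6 and 1 / 3; \<open>s\<close> is the product of their moduli and weighs the
    off-diagonal entries.\<close>
  define c where "c = b 0 0 / 6 + b 1 1 / 3"
  define \<omega> where "\<omega> = Complex (- 1 / 2) (sqrt 3 / 2)"
  define val where "val = (\<lambda>a. \<Sum>i<2. \<Sum>j<2. tetra_vec a i * cnj (tetra_vec a j) * b j i)"
  have sq: "complex_of_real (sqrt x) * of_real (sqrt x) = of_real x" if "0 \<le> x" for x
    using that by (simp flip: of_real_mult)
  have cnj\<omega>: "cnj \<omega> = Complex (- 1 / 2) (- sqrt 3 / 2)" by (simp add: \<omega>_def complex_eq_iff)
  have \<omega>\<omega>: "\<omega> * cnj \<omega> = 1" by (simp add: \<omega>_def complex_eq_iff)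
  have entries: "tetra_vec a 0 = of_real (sqrt (1 / 6))" if "a \<noteq> 0" for a
    using that by (simp add: tetra_vec_def)
  have entries1: "tetra_vec 1 1 = of_real (sqrt (1 / 3)) * \<omega>" "tetra_vec 2 1 = of_real (sqrt (1 / 3)) * cnj \<omega>"
    "tetra_vec 3 1 = of_real (sqrt (1 / 3))"
    unfolding cnj\<omega> by (simp_all add: tetra_vec_def \<omega>_def)
  have expand: "val a = (tetra_vec a 0 * cnj (tetra_vec a 0)) * b 0 0 + (tetra_vec a 1 * cnj (tetra_vec a 1)) * b 1 1
      + (tetra_vec a 1 * cnj (tetra_vec a 0) * b 0 1 + tetra_vec a 0 * cnj (tetra_vec a 1) * b 1 0)" for a
    by (simp add: val_def eval_nat_numeral)
  have general: "val a = c + (z * (s * b 0 1) + cnj z * (s * b 1 0))"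
    if "a \<noteq> 0" "tetra_vec a 1 = of_real (sqrt (1 / 3)) * z" "z * cnj z = 1" for a z
  proof -
    have "tetra_vec a 0 * cnj (tetra_vec a 0) = 1 / 6"
      using sq[of "1 / 6"] by (simp add: entries[OF that(1)])
    moreover have "tetra_vec a 1 * cnj (tetra_vec a 1) = 1 / 3"
    proof -
      have "tetra_vec a 1 * cnj (tetra_vec a 1)
          = (of_real (sqrt (1 / 3)) * of_real (sqrt (1 / 3))) * (z * cnj z)"
        unfolding that(2) by (simp only: complex_cnj_mult complex_cnj_complex_of_real mult_ac)
      moreover have "complex_of_real (sqrt (1 / 3)) * of_real (sqrt (1 / 3)) = 1 / 3"
        using sq[of "1 / 3"] by simp
      ultimately show ?thesis by (simp only: that(3) mult_1_right)
    qed
    moreover have "tetra_vec a 1 * cnj (tetra_vec a 0) = z * s" "tetra_vec a 0 * cnj (tetra_vec a 1) = cnj z * s"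
      unfolding that(2) entries[OF that(1)] s_def
      by (simp_all only: complex_cnj_mult complex_cnj_complex_of_real of_real_mult mult_ac)
    ultimately show ?thesis unfolding expand
      by (simp only:) (simp add: c_def mult.assoc)
  qed
  have val0: "val 0 = b 0 0 / 2"
    using sq[of "1 / 2"] by (simp add: expand tetra_vec_def mult.assoc)
  have val1: "val 1 = c + (\<omega> * (s * b 0 1) + cnj \<omega> * (s * b 1 0))"
    using general[of 1 \<omega>] entries1 \<omega>\<omega> by simp
  have val2: "val 2 = c + (cnj \<omega> * (s * b 0 1) + \<omega> * (s * b 1 0))"
    using general[of 2 "cnj \<omega>"] entries1 \<omega>\<omega> by (simp add: mult.commute[of "cnj \<omega>"])
  have val3: "val 3 = c + (s * b 0 1 + s * b 1 0)"
    using general[of 3 1] entries1 by simp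
  have "(\<Sum>a<4. (cmod (val a))\<^sup>2) = (cmod (val 0))\<^sup>2 + ((cmod (val 1))\<^sup>2 + (cmod (val 2))\<^sup>2 + (cmod (val 3))\<^sup>2)"
    by (simp add: eval_nat_numeral)
  also have "\<dots> = (cmod (b 0 0))\<^sup>2 / 4 + 3 * ((cmod c)\<^sup>2 + ((cmod (b 0 1))\<^sup>2 + (cmod (b 1 0))\<^sup>2) / 18)"
    unfolding val0 val1 val2 val3 using parseval_cube_roots[of c "s * b 0 1" "s * b 1 0", folded \<omega>_def] s
    by (simp add: norm_mult norm_divide power_mult_distrib power_divide)
  also have "\<dots> \<ge> 1 / 6 * (\<Sum>i<2. \<Sum>j<2. (cmod (b i j))\<^sup>2)"
  proof -
    \<comment> \<open>The diagonal terms of all four outcomes regroup into Frobenius part and trace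
      part.\<close>
    have "(cmod (b 0 0))\<^sup>2 / 4 + 3 * (cmod c)\<^sup>2
        = ((cmod (b 0 0))\<^sup>2 + (cmod (b 1 1))\<^sup>2) / 6 + (cmod (b 0 0 + b 1 1))\<^sup>2 / 6"
      unfolding cmod_power2 c_def by (simp add: power2_eq_square field_simps)
    moreover have "0 \<le> (cmod (b 0 0 + b 1 1))\<^sup>2 / 6" by simp
    moreover have "(\<Sum>i<2. \<Sum>j<2. (cmod (b i j))\<^sup>2)
        = (cmod (b 0 0))\<^sup>2 + (cmod (b 0 1))\<^sup>2 + ((cmod (b 1 0))\<^sup>2 + (cmod (b 1 1))\<^sup>2)"
      by (simp add: numeral_2_eq_2)
    moreover have "1 / 6 * s \<le> x / 4 + 3 * (k + (y + z) / 18)"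
      if "x / 4 + 3 * k = (x + w) / 6 + t / 6" "0 \<le> t / 6" "s = x + y + (z + w)" for s t w x y z k :: real
      using that by (simp add: field_simps)
    ultimately show ?thesis by blast
  qed
  finally show ?thesis unfolding val_def .
qed

lemma tetra_povm_length [simp]: "length tetra_povm = 4"
  by (simp add: tetra_povm_def)

lemma tetra_povm_nth: "a < 4 \<Longrightarrow> tetra_povm ! a = mat 2 2 (\<lambda>(i, j). tetra_vec a i * cnj (tetra_vec a j))"
  by (simp add: tetra_povm_def)

lemma rank_one_psd: "positive_semidefinite n (mat n n (\<lambda>(i, j). w i * cnj (w j)))"
proof -
  have "(\<Sum>i<n. \<Sum>j<n. mat n n (\<lambda>(i, j). w i * cnj (w j)) $$ (i, j) * u j * cnj (u i))
    = of_real ((cmod (\<Sum>i<n. w i * cnj (u i)))\<^sup>2)" for u :: "nat \<Rightarrow> complex"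
    unfolding complex_norm_square cnj_sum sum_product by (intro sum.cong refl) simp
  then show ?thesis by (simp add: positive_semidefinite_iff complex_nonneg_iff)
qed

lemma foldr_add_mat:
  fixes Es :: "'a::comm_monoid_add mat list"
  assumes "set Es \<subseteq> carrier_mat n m"
  shows "foldr (+) Es (0\<^sub>m n m) = mat n m (\<lambda>ij. \<Sum>E\<leftarrow>Es. E $$ ij)"
  using assms
proof (induction Es)
  case (Cons E Es)
  then show ?case by (intro eq_matI) auto
qed auto

lemma povm_tetra: "povm 2 tetra_povm"
proof -
  have "foldr (+) tetra_povm (0\<^sub>m 2 2) = mat 2 2 (\<lambda>ij. \<Sum>E\<leftarrow>tetra_povm. E $$ ij)"
    by (rule foldr_add_mat) (auto simp: tetra_povm_def)
  also have "\<dots> = 1\<^sub>m 2"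
  proof (rule eq_matI)
    fix i j assume ij: "i < dim_row (1\<^sub>m 2 :: complex mat)" "j < dim_col (1\<^sub>m 2 :: complex mat)"
    then have "(\<Sum>E\<leftarrow>tetra_povm. E $$ (i, j)) = (\<Sum>a<4. tetra_vec a i * cnj (tetra_vec a j))"
      by (simp add: tetra_povm_def o_def atLeast0LessThan flip: sum_list_distinct_conv_sum_set)
        (simp add: eval_nat_numeral)
    then show "mat 2 2 (\<lambda>ij. \<Sum>E\<leftarrow>tetra_povm. E $$ ij) $$ (i, j) = 1\<^sub>m 2 $$ (i, j)"
      using ij tetra_sum[of i j] by simp
  qed auto
  finally show ?thesis
    by (auto simp: povm_def tetra_povm_def rank_one_psd)
qed

section \<open>Tensor powers of the tetrahedral measurement\<close>

text \<open>The product vector whose rank-one matrix is the effect of the outcome string; quotient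
  and remainder split off the leading qubit as in \<open>kronecker\<close>.\<close>

fun tetra_product_vec :: "nat list \<Rightarrow> nat \<Rightarrow> complex" where
  "tetra_product_vec [] i = 1"
| "tetra_product_vec (a # x) i =
    tetra_vec a (i div 2 ^ length x) * tetra_product_vec x (i mod 2 ^ length x)"

abbreviation tetra_outcomes :: "nat \<Rightarrow> nat list set" where
  "tetra_outcomes m \<equiv> outcomes (replicate m tetra_povm)"

abbreviation tetra_effect :: "nat \<Rightarrow> nat list \<Rightarrow> complex mat" where
  "tetra_effect m \<equiv> effect (replicate m tetra_povm)"

text \<open>The trace of a product effect against a matrix, given by its entries so that
  restricting to blocks is function composition.\<close>

definition tetra_value :: "nat list \<Rightarrow> (nat \<Rightarrow> nat \<Rightarrow> complex) \<Rightarrow> complex" where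
  "tetra_value x f = (\<Sum>i<2 ^ length x. \<Sum>j<2 ^ length x.
    tetra_product_vec x i * cnj (tetra_product_vec x j) * f j i)"

lemma sum_tetra_outcomes_Suc:
  "(\<Sum>x\<in>tetra_outcomes (Suc m). f x) = (\<Sum>a<4. \<Sum>x\<in>tetra_outcomes m. f (a # x))"
  by (simp add: sum_outcomes_Cons)

lemma length_tetra_outcomes: "x \<in> tetra_outcomes m \<Longrightarrow> length x = m"
  by (drule length_outcomes) simp

lemma tetra_effect_eq:
  "x \<in> tetra_outcomes m \<Longrightarrow>
    tetra_effect m x = mat (2 ^ m) (2 ^ m) (\<lambda>(i, j). tetra_product_vec x i * cnj (tetra_product_vec x j))"
proof (induction m arbitrary: x)
  case 0
  then show ?case by (auto intro!: eq_matI)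
next
  case (Suc m)
  then obtain a y where x: "x = a # y" "a < 4" "y \<in> tetra_outcomes m"
    by (auto simp: outcomes_Cons)
  show ?case
    using x Suc.IH[OF x(3)] length_tetra_outcomes[OF x(3)]
    by (auto simp: effect_Cons tetra_povm_nth kronecker_def less_mult_imp_div_less intro!: eq_matI)
qed

lemma mat_trace_tetra_effect:
  assumes "x \<in> tetra_outcomes m" "A \<in> carrier_mat (2 ^ m) (2 ^ m)"
  shows "mat_trace (tetra_effect m x * A) = tetra_value x (\<lambda>i j. A $$ (i, j))"
proof -
  have "tetra_effect m x \<in> carrier_mat (2 ^ m) (2 ^ m)"
    using tetra_effect_eq[OF assms(1)] by simp
  from mat_trace_mult[OF this assms(2)] show ?thesis
    using assms by (simp add: tetra_effect_eq tetra_value_def length_tetra_outcomes)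
qed

text \<open>The recursion behind all facts on tensor powers: evaluate the remaining qubits on each
  of the four blocks, then the leading qubit on the resulting 2 x 2 matrix.\<close>

lemma tetra_value_Cons:
  "tetra_value (a # x) f = (\<Sum>s<2. \<Sum>t<2. tetra_vec a s * cnj (tetra_vec a t)
    * tetra_value x (\<lambda>k l. f (t * 2 ^ length x + k) (s * 2 ^ length x + l)))"
proof -
  let ?d = "2 ^ length x :: nat"
  have W: "tetra_product_vec (a # x) (s * ?d + k) = tetra_vec a s * tetra_product_vec x k" if "k < ?d" for s k
    using that by simp
  have "tetra_value (a # x) f = (\<Sum>s<2. \<Sum>k<?d. \<Sum>t<2. \<Sum>l<?d.
      tetra_product_vec (a # x) (s * ?d + k) * cnj (tetra_product_vec (a # x) (t * ?d + l))
        * f (t * ?d + l) (s * ?d + k))"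
    by (simp only: tetra_value_def list.size power_add power_one_right add_0_right plus_nat.add_0
        power_Suc add_Suc_right sum_lessThan_mult)
  also have "\<dots> = (\<Sum>s<2. \<Sum>k<?d. \<Sum>t<2. \<Sum>l<?d. tetra_vec a s * cnj (tetra_vec a t)
      * (tetra_product_vec x k * cnj (tetra_product_vec x l) * f (t * ?d + l) (s * ?d + k)))"
    by (intro sum.cong refl) (simp add: W del: tetra_product_vec.simps)
  also have "\<dots> = (\<Sum>s<2. \<Sum>t<2. \<Sum>k<?d. \<Sum>l<?d. tetra_vec a s * cnj (tetra_vec a t)
      * (tetra_product_vec x k * cnj (tetra_product_vec x l) * f (t * ?d + l) (s * ?d + k)))"
    by (intro sum.cong refl sum.swap)
  finally show ?thesis by (simp only: tetra_value_def sum_distrib_left)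
qed

text \<open>Completeness of the product measurement. Summing over the leading outcome keeps only the
  two diagonal blocks, to which the induction hypothesis applies.\<close>

lemma sum_tetra_value: "(\<Sum>x\<in>tetra_outcomes m. tetra_value x f) = (\<Sum>i<2 ^ m. f i i)"
proof (induction m arbitrary: f)
  case 0
  show ?case by (simp add: tetra_value_def)
next
  case (Suc m)
  let ?g = "\<lambda>s t x. tetra_value x (\<lambda>k l. f (t * 2 ^ m + k) (s * 2 ^ m + l))"
  have "(\<Sum>x\<in>tetra_outcomes (Suc m). tetra_value x f)
    = (\<Sum>a<4. \<Sum>x\<in>tetra_outcomes m. \<Sum>s<2. \<Sum>t<2. tetra_vec a s * cnj (tetra_vec a t) * ?g s t x)"
    unfolding sum_tetra_outcomes_Suc by (intro sum.cong refl) (simp add: tetra_value_Cons length_tetra_outcomes)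
  also have "\<dots> = (\<Sum>x\<in>tetra_outcomes m. \<Sum>a<4. \<Sum>s<2. \<Sum>t<2. tetra_vec a s * cnj (tetra_vec a t) * ?g s t x)"
    by (rule sum.swap)
  also have "\<dots> = (\<Sum>x\<in>tetra_outcomes m. \<Sum>s<2. \<Sum>t<2. (\<Sum>a<4. tetra_vec a s * cnj (tetra_vec a t)) * ?g s t x)"
  proof (rule sum.cong[OF refl])
    fix x
    have "(\<Sum>a<4. \<Sum>s<2. \<Sum>t<2. tetra_vec a s * cnj (tetra_vec a t) * ?g s t x)
      = (\<Sum>s<2. \<Sum>a<4. \<Sum>t<2. tetra_vec a s * cnj (tetra_vec a t) * ?g s t x)"
      by (rule sum.swap)
    also have "\<dots> = (\<Sum>s<2. \<Sum>t<2. \<Sum>a<4. tetra_vec a s * cnj (tetra_vec a t) * ?g s t x)"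
      by (intro sum.cong refl sum.swap)
    finally show "(\<Sum>a<4. \<Sum>s<2. \<Sum>t<2. tetra_vec a s * cnj (tetra_vec a t) * ?g s t x)
      = (\<Sum>s<2. \<Sum>t<2. (\<Sum>a<4. tetra_vec a s * cnj (tetra_vec a t)) * ?g s t x)"
      by (simp only: sum_distrib_right)
  qed
  also have "\<dots> = (\<Sum>x\<in>tetra_outcomes m. \<Sum>s<2. ?g s s x)"
  proof (intro sum.cong refl)
    fix x and s :: nat
    assume s: "s \<in> {..<2}"
    have "(\<Sum>t<2. (\<Sum>a<4. tetra_vec a s * cnj (tetra_vec a t)) * ?g s t x) = (\<Sum>t<2. if s = t then ?g s t x else 0)"
      using s by (intro sum.cong refl) (simp add: tetra_sum)
    then show "(\<Sum>t<2. (\<Sum>a<4. tetra_vec a s * cnj (tetra_vec a t)) * ?g s t x) = ?g s s x"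
      using s by simp
  qed
  also have "\<dots> = (\<Sum>s<2. \<Sum>x\<in>tetra_outcomes m. ?g s s x)" by (rule sum.swap)
  also have "\<dots> = (\<Sum>s<2. \<Sum>k<2 ^ m. f (s * 2 ^ m + k) (s * 2 ^ m + k))"
    by (intro sum.cong refl Suc.IH)
  also have "\<dots> = (\<Sum>i<2 ^ Suc m. f i i)" by (simp only: power_Suc sum_lessThan_mult)
  finally show ?case .
qed

text \<open>Tensorisation of the one-qubit bound: the induction hypothesis is applied to each of the
  four blocks, so \<open>f\<close> must be arbitrary, as an off-diagonal block of a Hermitian matrix
  need not be Hermitian.\<close>

lemma tetra_value_lower:
  "(1 / 6) ^ m * (\<Sum>i<2 ^ m. \<Sum>j<2 ^ m. (cmod (f i j))\<^sup>2)
    \<le> (\<Sum>x\<in>tetra_outcomes m. (cmod (tetra_value x f))\<^sup>2)"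
proof (induction m arbitrary: f)
  case 0
  show ?case by (simp add: tetra_value_def)
next
  case (Suc m)
  let ?d = "2 ^ m :: nat"
  let ?b = "\<lambda>x t s. tetra_value x (\<lambda>k l. f (t * ?d + k) (s * ?d + l))"
  have "(1 / 6) ^ Suc m * (\<Sum>i<2 ^ Suc m. \<Sum>j<2 ^ Suc m. (cmod (f i j))\<^sup>2)
    = (1 / 6) ^ Suc m * (\<Sum>t<2. \<Sum>k<?d. \<Sum>s<2. \<Sum>l<?d. (cmod (f (t * ?d + k) (s * ?d + l)))\<^sup>2)"
    by (simp only: power_Suc sum_lessThan_mult)
  also have "(\<Sum>t<2. \<Sum>k<?d. \<Sum>s<2. \<Sum>l<?d. (cmod (f (t * ?d + k) (s * ?d + l)))\<^sup>2)
    = (\<Sum>t<2. \<Sum>s<2. \<Sum>k<?d. \<Sum>l<?d. (cmod (f (t * ?d + k) (s * ?d + l)))\<^sup>2)"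
    by (intro sum.cong refl sum.swap)
  also have "(1 / 6) ^ Suc m * \<dots> = 1 / 6 * (\<Sum>t<2. \<Sum>s<2. (1 / 6) ^ m *
      (\<Sum>k<?d. \<Sum>l<?d. (cmod (f (t * ?d + k) (s * ?d + l)))\<^sup>2))"
    by (simp only: power_Suc sum_distrib_left mult.assoc)
  also have "\<dots> \<le> 1 / 6 * (\<Sum>t<2. \<Sum>s<2. \<Sum>x\<in>tetra_outcomes m. (cmod (?b x t s))\<^sup>2)"
    by (intro mult_left_mono sum_mono Suc.IH) auto
  also have "(\<Sum>t<2. \<Sum>s<2. \<Sum>x\<in>tetra_outcomes m. (cmod (?b x t s))\<^sup>2)
    = (\<Sum>t<2. \<Sum>x\<in>tetra_outcomes m. \<Sum>s<2. (cmod (?b x t s))\<^sup>2)"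
    by (intro sum.cong refl sum.swap)
  also have "\<dots> = (\<Sum>x\<in>tetra_outcomes m. \<Sum>t<2. \<Sum>s<2. (cmod (?b x t s))\<^sup>2)"
    by (rule sum.swap)
  also have "1 / 6 * \<dots> = (\<Sum>x\<in>tetra_outcomes m. 1 / 6 * (\<Sum>t<2. \<Sum>s<2. (cmod (?b x t s))\<^sup>2))"
    by (simp only: sum_distrib_left)
  \<comment> \<open>For each fixed outcome of the remaining qubits, the block values form a 2 x 2
    matrix to which the one-qubit bound applies.\<close>
  also have "\<dots> \<le> (\<Sum>x\<in>tetra_outcomes m. \<Sum>a<4.
      (cmod (\<Sum>s<2. \<Sum>t<2. tetra_vec a s * cnj (tetra_vec a t) * ?b x t s))\<^sup>2)"
    by (intro sum_mono tetra_frobenius_lower)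
  also have "\<dots> = (\<Sum>x\<in>tetra_outcomes m. \<Sum>a<4. (cmod (tetra_value (a # x) f))\<^sup>2)"
    by (intro sum.cong refl) (simp add: tetra_value_Cons length_tetra_outcomes)
  also have "\<dots> = (\<Sum>x\<in>tetra_outcomes (Suc m). (cmod (tetra_value x f))\<^sup>2)"
    unfolding sum_tetra_outcomes_Suc by (rule sum.swap)
  finally show ?case .
qed

lemma tetra_product_vec_norm:
  "x \<in> tetra_outcomes m \<Longrightarrow> (\<Sum>i<2 ^ m. (cmod (tetra_product_vec x i))\<^sup>2) = (1 / 2) ^ m"
proof (induction m arbitrary: x)
  case 0
  then show ?case by simp
next
  case (Suc m)
  then obtain a y where x: "x = a # y" "a < 4" "y \<in> tetra_outcomes m"
    by (auto simp: outcomes_Cons)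
  let ?d = "2 ^ m :: nat"
  have "(\<Sum>i<2 ^ Suc m. (cmod (tetra_product_vec x i))\<^sup>2)
    = (\<Sum>s<2. \<Sum>k<?d. (cmod (tetra_product_vec x (s * ?d + k)))\<^sup>2)"
    by (simp only: power_Suc sum_lessThan_mult)
  also have "\<dots> = (\<Sum>s<2. \<Sum>k<?d. (cmod (tetra_vec a s))\<^sup>2 * (cmod (tetra_product_vec y k))\<^sup>2)"
    using x(1) length_tetra_outcomes[OF x(3)]
    by (intro sum.cong refl) (simp add: norm_mult power_mult_distrib)
  also have "\<dots> = (1 / 2) ^ Suc m"
    by (simp only: tetra_norm[OF x(2)] Suc.IH[OF x(3)] power_Suc flip: sum_distrib_left sum_distrib_right)
  finally show ?case .
qed

section \<open>Outcome distributions of qubit states\<close>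

definition tetra_prob :: "nat \<Rightarrow> complex mat \<Rightarrow> nat list \<Rightarrow> real" where
  "tetra_prob m \<rho> x = Re (mat_trace (tetra_effect m x * \<rho>))"

text \<open>The trace is the quadratic form of \<rho> at the product vector of \<open>x\<close>,
  hence real and nonnegative. That vector has squared length 2^-m and \<rho> has trace 1, which
  gives the upper bound.\<close>

lemma tetra_prob_bounds:
  assumes x: "x \<in> tetra_outcomes m" and \<rho>: "qubit_state m \<rho>"
  shows "Im (mat_trace (tetra_effect m x * \<rho>)) = 0" "0 \<le> tetra_prob m \<rho> x" "tetra_prob m \<rho> x \<le> (1 / 2) ^ m"
proof -
  have psd: "positive_semidefinite (2 ^ m) \<rho>" and tr: "mat_trace \<rho> = 1"
    using \<rho> by (auto simp: density_operator_def)
  then have \<rho>c: "\<rho> \<in> carrier_mat (2 ^ m) (2 ^ m)" by (simp add: positive_semidefinite_def)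
  let ?w = "tetra_product_vec x"
  let ?q = "\<Sum>i<2 ^ m. \<Sum>j<2 ^ m. \<rho> $$ (i, j) * ?w j * cnj (?w i)"
  have val: "mat_trace (tetra_effect m x * \<rho>) = ?q"
    unfolding mat_trace_tetra_effect[OF x \<rho>c] tetra_value_def length_tetra_outcomes[OF x]
    by (subst sum.swap) (simp only: mult_ac)
  have "0 \<le> ?q" using psd by (simp add: positive_semidefinite_iff)
  then show "Im (mat_trace (tetra_effect m x * \<rho>)) = 0" "0 \<le> tetra_prob m \<rho> x"
    by (simp_all add: tetra_prob_def val complex_nonneg_iff)
  have "(\<Sum>i<2 ^ m. \<rho> $$ (i, i)) = 1" using tr \<rho>c by (simp add: mat_trace_def)
  then have "?q \<le> of_real ((1 / 2) ^ m)"
    using positive_semidefinite_le_trace[OF psd, of ?w] tetra_product_vec_norm[OF x] by simp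
  then show "tetra_prob m \<rho> x \<le> (1 / 2) ^ m"
    by (simp add: tetra_prob_def val less_eq_complex_def)
qed

lemma prob_weights_tetra:
  assumes \<rho>: "qubit_state m \<rho>"
  shows "prob_weights (tetra_outcomes m) (tetra_prob m \<rho>)"
proof -
  have \<rho>c: "\<rho> \<in> carrier_mat (2 ^ m) (2 ^ m)" and tr: "mat_trace \<rho> = 1"
    using \<rho> by (auto simp: density_operator_def positive_semidefinite_def)
  have "(\<Sum>x\<in>tetra_outcomes m. tetra_prob m \<rho> x) = Re (\<Sum>x\<in>tetra_outcomes m. tetra_value x (\<lambda>i j. \<rho> $$ (i, j)))"
    unfolding Re_sum tetra_prob_def by (intro sum.cong refl) (simp add: mat_trace_tetra_effect[OF _ \<rho>c])
  also have "\<dots> = 1" using tr \<rho>c by (simp add: sum_tetra_value mat_trace_def)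
  finally show ?thesis using tetra_prob_bounds(2)[OF _ \<rho>] by (simp add: prob_weights_def)
qed

lemma tetra_prob_distance:
  assumes \<rho>: "qubit_state m \<rho>" and \<sigma>: "qubit_state m \<sigma>" and \<epsilon>: "0 \<le> \<epsilon>" "\<epsilon> \<le> trace_norm (\<rho> - \<sigma>)"
  shows "\<epsilon>\<^sup>2 / 12 ^ m \<le> (\<Sum>x\<in>tetra_outcomes m. (tetra_prob m \<rho> x - tetra_prob m \<sigma> x)\<^sup>2)"
proof -
  let ?d = "2 ^ m :: nat"
  have \<rho>c: "\<rho> \<in> carrier_mat ?d ?d" and \<sigma>c: "\<sigma> \<in> carrier_mat ?d ?d"
    using \<rho> \<sigma> by (auto simp: density_operator_def positive_semidefinite_def)
  then have \<Delta>c: "\<rho> - \<sigma> \<in> carrier_mat ?d ?d" by (intro minus_carrier_mat)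
  have "mat_adjoint (\<rho> - \<sigma>) = \<rho> - \<sigma>"
  proof (rule eq_matI)
    fix i j assume "i < dim_row (\<rho> - \<sigma>)" "j < dim_col (\<rho> - \<sigma>)"
    then have ij: "j < ?d" "i < ?d" using \<sigma>c by auto
    have "\<rho> $$ (i, j) = cnj (\<rho> $$ (j, i))" "\<sigma> $$ (i, j) = cnj (\<sigma> $$ (j, i))"
      using \<rho> \<sigma> ij unfolding density_operator_def by (metis positive_semidefinite_hermitian)+
    moreover have "mat_adjoint (\<rho> - \<sigma>) $$ (i, j) = cnj (\<rho> $$ (j, i)) - cnj (\<sigma> $$ (j, i))"
      using ij \<sigma>c by (simp add: mat_adjoint_index)
    ultimately show "mat_adjoint (\<rho> - \<sigma>) $$ (i, j) = (\<rho> - \<sigma>) $$ (i, j)"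
      using ij \<sigma>c by simp
  qed (use \<rho>c \<sigma>c in auto)
  then have "(trace_norm (\<rho> - \<sigma>))\<^sup>2 \<le> 2 ^ m * (\<Sum>i<?d. \<Sum>j<?d. (cmod ((\<rho> - \<sigma>) $$ (i, j)))\<^sup>2)"
    using trace_norm_le_frobenius[OF \<Delta>c] by simp
  then have "\<epsilon>\<^sup>2 \<le> 2 ^ m * (\<Sum>i<?d. \<Sum>j<?d. (cmod ((\<rho> - \<sigma>) $$ (i, j)))\<^sup>2)"
    using power_mono[OF \<epsilon>(2,1), of 2] by linarith
  then have "\<epsilon>\<^sup>2 / 12 ^ m \<le> (2 ^ m * (\<Sum>i<?d. \<Sum>j<?d. (cmod ((\<rho> - \<sigma>) $$ (i, j)))\<^sup>2)) / 12 ^ m"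
    by (rule divide_right_mono) simp
  also have "\<dots> = (1 / 6) ^ m * (\<Sum>i<?d. \<Sum>j<?d. (cmod ((\<rho> - \<sigma>) $$ (i, j)))\<^sup>2)"
  proof -
    have "(12 :: real) ^ m = 2 ^ m * 6 ^ m" by (simp flip: power_mult_distrib)
    then show ?thesis by (simp add: power_one_over divide_simps)
  qed
  also have "\<dots> \<le> (\<Sum>x\<in>tetra_outcomes m. (cmod (tetra_value x (\<lambda>i j. (\<rho> - \<sigma>) $$ (i, j))))\<^sup>2)"
    by (rule tetra_value_lower)
  also have "\<dots> = (\<Sum>x\<in>tetra_outcomes m. (tetra_prob m \<rho> x - tetra_prob m \<sigma> x)\<^sup>2)"
  proof (intro sum.cong refl)
    fix x assume x: "x \<in> tetra_outcomes m"
    have "tetra_value x (\<lambda>i j. (\<rho> - \<sigma>) $$ (i, j))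
        = tetra_value x (\<lambda>i j. \<rho> $$ (i, j)) - tetra_value x (\<lambda>i j. \<sigma> $$ (i, j))"
      unfolding tetra_value_def length_tetra_outcomes[OF x] sum_subtractf[symmetric]
      using \<rho>c \<sigma>c by (intro sum.cong refl) (simp add: right_diff_distrib)
    also have "\<dots> = of_real (tetra_prob m \<rho> x - tetra_prob m \<sigma> x)"
      using tetra_prob_bounds(1)[OF x \<rho>] tetra_prob_bounds(1)[OF x \<sigma>]
      unfolding mat_trace_tetra_effect[OF x \<rho>c, symmetric] mat_trace_tetra_effect[OF x \<sigma>c, symmetric]
      by (simp add: complex_eq_iff tetra_prob_def)
    finally show "(cmod (tetra_value x (\<lambda>i j. (\<rho> - \<sigma>) $$ (i, j))))\<^sup>2 = (tetra_prob m \<rho> x - tetra_prob m \<sigma> x)\<^sup>2"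
      by (simp only: norm_of_real power2_abs)
  qed
  finally show ?thesis .
qed

section \<open>From quantum copies to classical samples\<close>

text \<open>For any rule reading one outcome string per copy, the answer has the law obtained from
  independent samples, \<open>n\<close> from each outcome distribution. This is the only passage
  from the quantum statement to the classical test.\<close>

lemma answer_prob_joint_copies:
  assumes \<rho>: "qubit_state m \<rho>" and \<sigma>: "qubit_state m \<sigma>"
  shows "answer_prob (concat (replicate (2 * n) (replicate m tetra_povm)))
      (\<lambda>x. dec (chunks m (2 * n) x)) (joint_copies n \<rho> \<sigma>) a
    = expect (tetra_outcomes m) (replicate n (tetra_prob m \<rho>) @ replicate n (tetra_prob m \<sigma>))
        (\<lambda>xs. of_bool (dec xs = a))"
proof -
  let ?Ms = "replicate m tetra_povm"
  let ?\<omega>s = "replicate n \<rho> @ replicate n \<sigma>"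
  let ?Ns = "concat (replicate (2 * n) ?Ms)"
  have \<rho>c: "\<rho> \<in> carrier_mat (2 ^ m) (2 ^ m)" and \<sigma>c: "\<sigma> \<in> carrier_mat (2 ^ m) (2 ^ m)"
    using \<rho> \<sigma> by (auto simp: density_operator_def positive_semidefinite_def)
  have len: "length ?\<omega>s = 2 * n" by simp
  have "answer_prob ?Ns (\<lambda>x. dec (chunks m (2 * n) x)) (joint_copies n \<rho> \<sigma>) a
    = (\<Sum>x\<in>outcomes ?Ns. Re (mat_trace (effect ?Ns x * tensor_list ?\<omega>s)) * of_bool (dec (chunks m (2 * n) x) = a))"
    unfolding answer_prob_def joint_copies_def
    by (intro sum.mono_neutral_cong_left) (auto simp: finite_outcomes)
  also have "\<dots> = expect (outcomes ?Ms) (map (\<lambda>\<omega> x. Re (mat_trace (effect ?Ms x * \<omega>))) ?\<omega>s)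
      (\<lambda>xs. of_bool (dec (chunks m (2 * n) (concat xs)) = a))"
  proof (rule sum_effect_tensor[where \<omega>s = ?\<omega>s and Ms = ?Ms and d = 2, unfolded len])
    show "\<forall>Es\<in>set ?Ms. set Es \<subseteq> carrier_mat 2 2" by (auto simp: tetra_povm_def)
  qed (use \<rho>c \<sigma>c tetra_prob_bounds(1)[OF _ \<rho>] tetra_prob_bounds(1)[OF _ \<sigma>] in auto)
  also have "\<dots> = expect (outcomes ?Ms) (map (\<lambda>\<omega> x. Re (mat_trace (effect ?Ms x * \<omega>))) ?\<omega>s)
      (\<lambda>xs. of_bool (dec xs = a))"
  proof (rule expect_cong)
    fix xs assume "length xs = length (map (\<lambda>\<omega> x. Re (mat_trace (effect ?Ms x * \<omega>))) ?\<omega>s)"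
      and "set xs \<subseteq> outcomes ?Ms"
    then have "length xs = 2 * n" "\<forall>x\<in>set xs. length x = m"
      by (auto dest: length_tetra_outcomes)
    then have "chunks m (2 * n) (concat xs) = xs" by (metis chunks_concat)
    then show "(of_bool (dec (chunks m (2 * n) (concat xs)) = a) :: real) = of_bool (dec xs = a)" by simp
  qed
  finally show ?thesis by (simp add: tetra_prob_def[abs_def])
qed

theorem theorem1p2p6:
  shows "\<exists>K :: real. \<forall>(m :: nat) (\<epsilon> :: real). 1 \<le> m \<longrightarrow> 0 < \<epsilon> \<longrightarrow> \<epsilon> \<le> 1 \<longrightarrow>
           (\<exists>(n :: nat) Ms decide.
              real n \<le> K * (6 * sqrt 2) ^ m / \<epsilon>\<^sup>2 \<and>
              local_measurement (2 * n * m) Ms \<and>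
              (\<forall>\<rho> \<sigma>. qubit_state m \<rho> \<longrightarrow> qubit_state m \<sigma> \<longrightarrow>
                 (\<rho> = \<sigma> \<longrightarrow>
                    answer_prob Ms decide (joint_copies n \<rho> \<sigma>) Yes \<ge> 2 / 3) \<and>
                 (trace_norm (\<rho> - \<sigma>) \<ge> \<epsilon> \<longrightarrow>
                    answer_prob Ms decide (joint_copies n \<rho> \<sigma>) No \<ge> 2 / 3)))"
proof (rule exI[of _ 202], intro allI impI)
  fix m :: nat and \<epsilon> :: real
  assume \<epsilon>: "0 < \<epsilon>" "\<epsilon> \<le> 1"
  define r where "r = (6 * sqrt 2) ^ m / \<epsilon>\<^sup>2"
  define N where "N = nat \<lceil>100 * r\<rceil>"
  define \<theta> where "\<theta> = \<epsilon>\<^sup>2 / 12 ^ m"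
  define \<beta> where "\<beta> = (1 / 2 :: real) ^ m"
  define dec where "dec = (\<lambda>xs :: nat list list. if collision_test N \<theta> xs then Yes else No)"
  have "1 \<le> sqrt 2" by simp
  then have "1 \<le> (6 * sqrt 2) ^ m" by (intro one_le_power) linarith
  moreover have "\<epsilon>\<^sup>2 \<le> 1" using \<epsilon> by (simp add: power_le_one)
  ultimately have r: "1 \<le> r" unfolding r_def using \<epsilon> by (simp add: field_simps)
  \<comment> \<open>Rounding up costs at most 1, which is at most \<open>r\<close>. The test takes
    \<open>2 * N\<close> samples of each distribution, so 202 \<open>r\<close> bounds the copies of
    each state.\<close>
  have N: "100 * r \<le> N" "N \<le> 101 * r" using r by (auto simp: N_def) linarith
  \<comment> \<open>The balance that fixes the rate: 6 sqrt 2 / 12 = sqrt (1 / 2), so dividing by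
    12^m leaves exactly sqrt \<beta>.\<close>
  have r\<theta>: "r * \<theta> = sqrt \<beta>"
  proof -
    have "x / \<epsilon>\<^sup>2 * (\<epsilon>\<^sup>2 / y) = x / y" for x y using \<epsilon> by simp
    then have "r * \<theta> = ((6 * sqrt 2) / 12) ^ m" unfolding r_def \<theta>_def power_divide .
    also have "(6 * sqrt 2) / 12 = sqrt (1 / 2)" by (simp add: real_sqrt_divide field_simps)
    finally show ?thesis by (simp add: \<beta>_def real_sqrt_power)
  qed
  have \<theta>: "0 < \<theta>" using \<epsilon> by (simp add: \<theta>_def)
  have N\<theta>: "100 * sqrt \<beta> \<le> N * \<theta>"
    using mult_right_mono[OF N(1), of \<theta>] \<theta> by (simp add: r\<theta>[symmetric])
  have \<beta>: "0 < \<beta>" "\<beta> \<le> 1" by (simp_all add: \<beta>_def power_le_one)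
  \<comment> \<open>Two states with \<open>2 * N\<close> copies each, one block of \<open>m\<close>
    qubit measurements per copy.\<close>
  let ?Ms = "concat (replicate (2 * (2 * N)) (replicate m tetra_povm))"
  let ?decide = "\<lambda>x. dec (chunks m (2 * (2 * N)) x)"
  have yes: "dec xs = Yes \<longleftrightarrow> collision_test N \<theta> xs" and no: "dec xs = No \<longleftrightarrow> \<not> collision_test N \<theta> xs" for xs
    by (simp_all add: dec_def)
  show "\<exists>(n :: nat) Ms decide.
      real n \<le> 202 * (6 * sqrt 2) ^ m / \<epsilon>\<^sup>2 \<and> local_measurement (2 * n * m) Ms \<and>
      (\<forall>\<rho> \<sigma>. qubit_state m \<rho> \<longrightarrow> qubit_state m \<sigma> \<longrightarrow>
        (\<rho> = \<sigma> \<longrightarrow> answer_prob Ms decide (joint_copies n \<rho> \<sigma>) Yes \<ge> 2 / 3) \<and>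
        (trace_norm (\<rho> - \<sigma>) \<ge> \<epsilon> \<longrightarrow> answer_prob Ms decide (joint_copies n \<rho> \<sigma>) No \<ge> 2 / 3))"
  proof (intro exI[of _ "2 * N"] exI[of _ ?Ms] exI[of _ ?decide] conjI allI impI)
    show "real (2 * N) \<le> 202 * (6 * sqrt 2) ^ m / \<epsilon>\<^sup>2"
      using N(2) by (simp add: r_def)
    show "local_measurement (2 * (2 * N) * m) ?Ms"
      using povm_tetra by (auto simp: local_measurement_def length_concat sum_list_replicate)
  next
    fix \<rho> \<sigma>
    assume \<rho>: "qubit_state m \<rho>" and \<sigma>: "qubit_state m \<sigma>"
    have bound: "\<forall>x\<in>tetra_outcomes m. tetra_prob m \<rho> x \<le> \<beta> \<and> tetra_prob m \<sigma> x \<le> \<beta>"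
      using tetra_prob_bounds(3) \<rho> \<sigma> by (simp add: \<beta>_def)
    note test = collision_test_correct[OF finite_outcomes prob_weights_tetra[OF \<rho>] prob_weights_tetra[OF \<sigma>]
        bound \<beta> \<theta> N\<theta>]
    show "answer_prob ?Ms ?decide (joint_copies (2 * N) \<rho> \<sigma>) Yes \<ge> 2 / 3" if "\<rho> = \<sigma>"
      unfolding answer_prob_joint_copies[OF \<rho> \<sigma>] yes by (rule test(1)) (simp add: that)
    show "answer_prob ?Ms ?decide (joint_copies (2 * N) \<rho> \<sigma>) No \<ge> 2 / 3" if "trace_norm (\<rho> - \<sigma>) \<ge> \<epsilon>"
      unfolding answer_prob_joint_copies[OF \<rho> \<sigma>] no
      by (rule test(2)) (use tetra_prob_distance[OF \<rho> \<sigma> _ that] \<epsilon> in \<open>simp add: \<theta>_def\<close>)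
  qed
qed

end
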